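(* Assume $\frac{22\pi-8}{15\pi}B^2< C<\frac{22}{15}B^2$, and assume $C\neq H(m)B^2$ for all integers $m\ge0$. Define $$n:=\max\Big\{m\in\mathbb Z_{\ge0}:\ C>\tfrac{22(4m+1)\pi-8}{15(4m+1)\pi}B^2\Big\},$$ and let $k$ be an integer with $0\le k\le n$. Then the $k$th Hopf bifurcation is subcritical, and for all sufficiently small $\eta>0$ the following hold. If $k<n$, then $$\frac{4+\frac{2\eta}{(n-k+1)\pi}}{4k+1-\frac{2\eta}{\pi}}<T^k_\eta<\frac{4+\frac{2\eta}{(n-k)\pi}}{4k+1-\frac{2\eta}{\pi}}.$$ If $k=n$, then $$T^k_\eta>\frac{4+\frac{2\eta}{\pi}}{4k+1-\frac{2\eta}{\pi}}.$$
   Context: Consider the scalar delay differential equation (1) $x'(t)=-\mu f(x(t-1))$, with real parameter $\mu$ and phase space $C([-1,0],\mathbb R)$. Here $f:\mathbb R\to\mathbb R$ is $C^3$ with $f(0)=0$ and $f'(0)=1$, so that $f(\xi)=\xi+B\xi^2+C\xi^3+o(\xi^3)$ with $B=f''(0)/2$ and $C=f'''(0)/6$. For $k\in\mathbb Z$ let $\mu_k=\frac{(4k+1)\pi}{2}$ and $H(k)=\frac{22(4k+1)\pi-8}{15(4k+1)\pi}$. The $k$th Hopf bifurcation (at $\mu_k$) is supercritical if $C<H(k)B^2$ and subcritical if $C>H(k)B^2$; it is called nondegenerate if $C\ne H(k)B^2$. Supercritical means the bifurcating small periodic orbits are stable within the center manifold; subcritical means they are unstable there. Hopf branch notation, for $k\ge0$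 with a nondegenerate $k$th bifurcation: put $\delta_k=1$ if it is supercritical and $\delta_k=-1$ if it is subcritical. There are $\eta_k>0$ and a family of nonconstant periodic solutions $p^k_\eta$, $\eta\in(0,\eta_k)$, of (1) with parameter $\mu=\mu_k+\delta_k\eta$. These bifurcate from $0$ at $\mu_k$ (amplitude $\to0$ as $\eta\to0$), and they are locally unique up to time translation. $T^k_\eta$ denotes the minimal period of $p^k_\eta$, and $T^k_\eta\to T^k_0:=\frac{4}{4k+1}$ as $\eta\to0$. *)

theory Defs
  imports "HOL-Analysis.Analysis"
begin

definition C3_fun :: "(real \<Rightarrow> real) \<Rightarrow> bool" where
  "C3_fun f \<longleftrightarrow> (\<forall>x. f differentiable at x) \<and> (\<forall>x. deriv f differentiable at x)
     \<and> (\<forall>x. deriv (deriv f) differentiable at x) \<and> continuous_on UNIV ((deriv ^^ 3) f)"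

definition coefB :: "(real \<Rightarrow> real) \<Rightarrow> real" where
  "coefB f = deriv (deriv f) 0 / 2"

definition coefC :: "(real \<Rightarrow> real) \<Rightarrow> real" where
  "coefC f = (deriv ^^ 3) f 0 / 6"

definition mu :: "nat \<Rightarrow> real" where
  "mu k = (4 * real k + 1) * pi / 2"

definition H :: "nat \<Rightarrow> real" where
  "H k = (22 * (4 * real k + 1) * pi - 8) / (15 * (4 * real k + 1) * pi)"

definition hopf_supercritical :: "(real \<Rightarrow> real) \<Rightarrow> nat \<Rightarrow> bool" where
  "hopf_supercritical f k \<longleftrightarrow> coefC f < H k * (coefB f)^2"

definition hopf_subcritical :: "(real \<Rightarrow> real) \<Rightarrow> nat \<Rightarrow> bool" where
  "hopf_subcritical f k \<longleftrightarrow> coefC f > H k * (coefB f)^2"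

definition hopf_delta :: "(real \<Rightarrow> real) \<Rightarrow> nat \<Rightarrow> real" where
  "hopf_delta f k = (if hopf_supercritical f k then 1 else -1)"

definition is_solution :: "real \<Rightarrow> (real \<Rightarrow> real) \<Rightarrow> (real \<Rightarrow> real) \<Rightarrow> bool" where
  "is_solution \<mu> f x \<longleftrightarrow> (\<forall>t. (x has_real_derivative (- \<mu> * f (x (t - 1)))) (at t))"

definition minimal_period :: "(real \<Rightarrow> real) \<Rightarrow> real \<Rightarrow> bool" where
  "minimal_period x T \<longleftrightarrow> T > 0 \<and> (\<forall>t. x (t + T) = x t)
     \<and> (\<forall>s. 0 < s \<and> s < T \<longrightarrow> \<not> (\<forall>t. x (t + s) = x t))"

definition hopf_branch ::
  "(real \<Rightarrow> real) \<Rightarrow> nat \<Rightarrow> real \<Rightarrow> (real \<Rightarrow> real \<Rightarrow> real) \<Rightarrow> (real \<Rightarrow> real) \<Rightarrow> bool" where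
  "hopf_branch f k \<eta>0 p T \<longleftrightarrow> \<eta>0 > 0
     \<and> (\<forall>\<eta>. 0 < \<eta> \<and> \<eta> < \<eta>0 \<longrightarrow>
          is_solution (mu k + hopf_delta f k * \<eta>) f (p \<eta>) \<and> minimal_period (p \<eta>) (T \<eta>))
     \<and> (\<forall>\<epsilon>>0. \<forall>\<^sub>F \<eta> in at_right 0. \<forall>t. \<bar>p \<eta> t\<bar> < \<epsilon>)
     \<and> (T \<longlongrightarrow> 4 / (4 * real k + 1)) (at_right 0)"

end

theory Submission
  imports Defs
begin

text \<open>
  Let \<open>x\<close> be a small periodic solution of period \<open>T\<close>, put \<open>\<omega> = 2 pi / T\<close>, \<open>\<kappa> = \<mu> / \<omega>\<close> and
  \<open>\<tau> = \<omega> - 2 pi k\<close>. Then \<open>u s = x (s / \<omega>)\<close> has period \<open>2 pi\<close> and solves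
  \<open>u' s = - \<kappa> f (u (s - \<tau>))\<close>, where \<open>(\<kappa>, \<tau>)\<close> is close to \<open>(1, pi/2)\<close>. At \<open>(1, pi/2)\<close> the linear part is
  invertible away from the first Fourier mode, so \<open>u = 2 Re (c cis s) + O(|c|\<^sup>2)\<close>. The exact equations
  for the modes \<open>0\<close>, \<open>1\<close>, \<open>2\<close> then give
  \<open>1 + \<i> cis \<tau> / \<kappa> = (X + \<i> Y) |c|\<^sup>2 + o(|c|\<^sup>2)\<close> with \<open>X = 22/5 B\<^sup>2 - 3 C\<close> and \<open>Y = 4/5 B\<^sup>2\<close>.
  Eliminating \<open>|c|\<^sup>2\<close> yields \<open>\<omega> = mu k - Y / (Y - X mu k) \<eta> + o(\<eta>)\<close>, while the definition of \<open>n\<close>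
  says \<open>X mu n < Y < X mu (n + 1)\<close>; the bounds on \<open>T\<close> are these two inequalities.
\<close>

section \<open>Fourier coefficients of periodic functions\<close>

text \<open>The argument lives on the whole line rather than on a circle; periodicity is assumed
  only where derivatives and shifts are taken.\<close>

definition fc :: "int \<Rightarrow> (real \<Rightarrow> complex) \<Rightarrow> complex" where
  "fc m \<phi> = integral {0..2 * pi} (\<lambda>s. \<phi> s * cis (- of_int m * s)) / (2 * pi)"

lemma continuous_on_cis_linear [continuous_intros]:
  "continuous_on A (\<lambda>s::real. cis (a * s))"
  by (intro continuous_on_cis continuous_intros)

lemma fc_integrable:
  assumes "continuous_on UNIV \<phi>"
  shows "(\<lambda>s. \<phi> s * cis (- of_int m * s)) integrable_on {0..2 * pi}"
  by (intro integrable_continuous_interval continuous_intros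
        continuous_on_subset[OF assms]) auto

lemma fc_add:
  assumes "continuous_on UNIV \<phi>" "continuous_on UNIV \<psi>"
  shows "fc m (\<lambda>s. \<phi> s + \<psi> s) = fc m \<phi> + fc m \<psi>"
  unfolding fc_def distrib_right
  by (subst integral_add[OF fc_integrable[OF assms(1)] fc_integrable[OF assms(2)]])
     (simp add: add_divide_distrib)

lemma fc_cmult: "fc m (\<lambda>s. c * \<phi> s) = c * fc m \<phi>"
  unfolding fc_def mult.assoc by simp

lemma fc_diff:
  assumes "continuous_on UNIV \<phi>" "continuous_on UNIV \<psi>"
  shows "fc m (\<lambda>s. \<phi> s - \<psi> s) = fc m \<phi> - fc m \<psi>"
  using fc_add[OF assms(1), of "\<lambda>s. (-1) * \<psi> s" m] fc_cmult[of m "-1" \<psi>] assms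
  by (simp add: continuous_on_minus)

lemma fc_norm_le:
  assumes "continuous_on UNIV \<phi>" "\<And>s. norm (\<phi> s) \<le> M"
  shows "norm (fc m \<phi>) \<le> M"
proof -
  have "norm (integral {0..2 * pi} (\<lambda>s. \<phi> s * cis (- of_int m * s))) \<le> M * (2 * pi - 0)"
    by (intro integral_bound continuous_intros continuous_on_subset[OF assms(1)])
       (auto simp: norm_mult assms(2))
  then show ?thesis
    by (simp add: fc_def norm_divide divide_le_eq)
qed

lemma fc_mult_cis: "fc m (\<lambda>s. cis (of_int j * s) * \<phi> s) = fc (m - j) \<phi>"
proof -
  have "cis (of_int j * s) * \<phi> s * cis (- of_int m * s) = \<phi> s * cis (- of_int (m - j) * s)" for s
  proof -
    have "cis (of_int j * s) * cis (- of_int m * s) = cis (- of_int (m - j) * s)"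
      unfolding cis_mult by (simp add: algebra_simps)
    then show ?thesis by (metis mult.assoc mult.commute)
  qed
  then show ?thesis by (simp only: fc_def)
qed

lemma has_vector_derivative_cis_linear [derivative_intros]:
  "((\<lambda>s. cis (a * s)) has_vector_derivative (\<i> * of_real a * cis (a * s))) (at s within A)"
proof -
  have "((\<lambda>z. exp (\<i> * of_real a * z)) has_field_derivative \<i> * of_real a * exp (\<i> * of_real a * of_real s))
      (at (of_real s))"
    by (auto intro!: derivative_eq_intros)
  from has_vector_derivative_real_field[OF this] show ?thesis
    by (simp add: cis_conv_exp mult.assoc)
qed

lemma cis_int_periodic: "cis (of_int m * (s + 2 * pi)) = cis (of_int m * s)"
proof -
  have "cis (of_int m * (s + 2 * pi)) = cis (of_int m * s) * cis (2 * pi * of_int m)"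
    unfolding cis_mult by (simp add: algebra_simps)
  then show ?thesis by simp
qed

text \<open>Integration by parts over one period: periodicity of \<open>\<phi>\<close> and of the
  exponential cancels the boundary terms. The integrability of \<open>\<phi>'\<close> times the
  exponential comes out of the fundamental theorem of calculus.\<close>

lemma fc_deriv:
  assumes "\<And>s. (\<phi> has_vector_derivative \<phi>' s) (at s)"
    and per: "\<And>s. \<phi> (s + 2 * pi) = \<phi> s"
  shows "fc m \<phi>' = \<i> * of_int m * fc m \<phi>"
proof -
  have cont: "continuous_on UNIV \<phi>"
    using assms(1) by (meson continuous_at_imp_continuous_on has_vector_derivative_continuous)
  let ?e = "\<lambda>s. cis (- of_int m * s)"
  have 1: "((\<lambda>s. \<phi> s * (\<i> * of_real (- of_int m) * ?e s) + \<phi>' s * ?e s) has_integral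
      \<phi> (2 * pi) * ?e (2 * pi) - \<phi> 0 * ?e 0) {0..2 * pi}"
    by (intro fundamental_theorem_of_calculus has_vector_derivative_mult has_vector_derivative_cis_linear)
       (auto intro: has_vector_derivative_at_within assms)
  have e: "\<phi> (2 * pi) * ?e (2 * pi) - \<phi> 0 * ?e 0 = 0"
    using per[of 0] cis_int_periodic[of "-m" 0] by simp
  have 2: "((\<lambda>s. (- \<i> * of_int m) * (\<phi> s * ?e s)) has_integral
      (- \<i> * of_int m) * integral {0..2*pi} (\<lambda>s. \<phi> s * ?e s)) {0..2*pi}"
    by (intro has_integral_mult_right integrable_integral fc_integrable cont)
  have "((\<lambda>s. \<phi>' s * ?e s) has_integral 0 - (- \<i> * of_int m) * integral {0..2*pi} (\<lambda>s. \<phi> s * ?e s)) {0..2*pi}"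
    using has_integral_diff[OF 1[unfolded e] 2] by (simp add: algebra_simps)
  then show ?thesis
    by (simp add: fc_def integral_unique)
qed

text \<open>For distinct indices, the coefficient of the derivative of the exponential is computed
  in two ways, once with the factor \<open>j\<close> and once with the factor \<open>m\<close>, so
  the coefficient must vanish.\<close>

lemma fc_cis: "fc m (\<lambda>s. cis (of_int j * s)) = (if m = j then 1 else 0)"
proof (cases "m = j")
  case True
  have "fc 0 (\<lambda>s. 1) = 1" by (simp add: fc_def scaleR_conv_of_real)
  then show ?thesis using fc_mult_cis[of m j "\<lambda>s. 1"] True by simp
next
  case False
  have "fc m (\<lambda>s. \<i> * of_real (of_int j) * cis (of_int j * s)) = \<i> * of_int m * fc m (\<lambda>s. cis (of_int j * s))"
    by (rule fc_deriv[OF has_vector_derivative_cis_linear cis_int_periodic])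
  then have "(\<i> * of_int j) * fc m (\<lambda>s. cis (of_int j * s)) = \<i> * of_int m * fc m (\<lambda>s. cis (of_int j * s))"
    by (simp add: fc_cmult)
  then show ?thesis using False by simp
qed

text \<open>An antiderivative grows by the same amount over every interval of length
  \<open>p\<close>, since \<open>\<Phi> (p + x) - \<Phi> x\<close> has derivative zero by
  periodicity. The two integrals are this growth at \<open>x = - \<tau>\<close> and at
  \<open>x = 0\<close>.\<close>

lemma integral_periodic_shift:
  fixes \<phi> :: "real \<Rightarrow> complex"
  assumes cont: "continuous_on UNIV \<phi>" and per: "\<And>s. \<phi> (s + p) = \<phi> s" and p: "p \<ge> 0"
  shows "integral {0..p} (\<lambda>s. \<phi> (s - \<tau>)) = integral {0..p} \<phi>"
proof -
  \<comment> \<open>The margin makes \<open>{-b..p + b}\<close> contain \<open>{0..p}\<close> and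
    its translate by \<open>- \<tau>\<close>, so that one antiderivative serves both
    integrals.\<close>
  define b where "b = \<bar>\<tau>\<bar> + 1"
  obtain \<Phi> where \<Phi>: "\<And>x. x \<in> {-b..p + b} \<Longrightarrow> (\<Phi> has_vector_derivative \<phi> x) (at x within {-b..p+b})"
    using antiderivative_continuous[of "-b" "p+b" \<phi>] continuous_on_subset[OF cont] by blast
  have int: "((\<lambda>s. \<phi> (s - t)) has_integral \<Phi> (p - t) - \<Phi> (0 - t)) {0..p}" if t: "\<bar>t\<bar> < b" for t
  proof (rule fundamental_theorem_of_calculus[OF p])
    fix x assume x: "x \<in> {0..p}"
    have "((\<Phi> \<circ> (\<lambda>s. s - t)) has_vector_derivative (1 *\<^sub>R \<phi> (x - t))) (at x within {0..p})"
      by (rule vector_diff_chain_within)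
         (use x t in \<open>auto intro!: derivative_eq_intros has_vector_derivative_within_subset[OF \<Phi>]\<close>)
    then show "((\<lambda>s. \<Phi> (s - t)) has_vector_derivative \<phi> (x - t)) (at x within {0..p})"
      by (simp add: o_def)
  qed
  have "\<exists>c. \<forall>x\<in>{-b..b}. \<Phi> (p + x) - \<Phi> x = c"
  proof -
    have "((\<lambda>x. \<Phi> (p + x) - \<Phi> x) has_vector_derivative 0) (at x within {-b..b})" if x: "x \<in> {-b..b}" for x
    proof -
      have "((\<Phi> \<circ> (\<lambda>s. p + s)) has_vector_derivative (1 *\<^sub>R \<phi> (p + x))) (at x within {-b..b})"
        by (rule vector_diff_chain_within)
           (use x p in \<open>auto intro!: derivative_eq_intros has_vector_derivative_within_subset[OF \<Phi>]\<close>)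
      moreover have "(\<Phi> has_vector_derivative \<phi> x) (at x within {-b..b})"
        by (rule has_vector_derivative_within_subset[OF \<Phi>]) (use x p in auto)
      ultimately show ?thesis
        using has_vector_derivative_diff[of "\<lambda>x. \<Phi> (p + x)" "\<phi> (p + x)" "at x within {-b..b}" \<Phi> "\<phi> x"] per[of x]
        by (simp add: o_def add.commute)
    qed
    then show ?thesis
      using has_vector_derivative_zero_constant[of "{-b..b}" "\<lambda>x. \<Phi> (p + x) - \<Phi> x"]
      by (metis convex_real_interval(5))
  qed
  moreover have "- \<tau> \<in> {-b..b}" "0 \<in> {-b..b}" by (auto simp: b_def)
  ultimately have "\<Phi> (p - \<tau>) - \<Phi> (0 - \<tau>) = \<Phi> (p - 0) - \<Phi> (0 - 0)"
    by (metis (no_types, lifting) add.right_neutral diff_conv_add_uminus diff_0 diff_0_right)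
  then show ?thesis
    using integral_unique[OF int[of \<tau>]] integral_unique[OF int[of 0]] by (simp add: b_def)
qed

lemma fc_shift:
  assumes cont: "continuous_on UNIV \<phi>" and per: "\<And>s. \<phi> (s + 2 * pi) = \<phi> s"
  shows "fc m (\<lambda>s. \<phi> (s - \<tau>)) = cis (- of_int m * \<tau>) * fc m \<phi>"
proof -
  let ?e = "\<lambda>s. cis (- of_int m * s)"
  have "integral {0..2*pi} (\<lambda>s. \<phi> (s - \<tau>) * ?e (s - \<tau>)) = integral {0..2*pi} (\<lambda>s. \<phi> s * ?e s)"
    by (rule integral_periodic_shift[where \<phi> = "\<lambda>s. \<phi> s * ?e s"])
       (use cis_int_periodic[of "-m"] in \<open>auto intro!: continuous_intros cont simp: per\<close>)
  moreover have "\<phi> (s - \<tau>) * ?e s = ?e \<tau> * (\<phi> (s - \<tau>) * ?e (s - \<tau>))" for s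
    by (simp add: cis_mult algebra_simps flip: mult.assoc)
  ultimately have "integral {0..2*pi} (\<lambda>s. \<phi> (s - \<tau>) * ?e s) = ?e \<tau> * integral {0..2*pi} (\<lambda>s. \<phi> s * ?e s)"
    by (simp only: integral_mult_right)
  then show ?thesis by (simp add: fc_def)
qed

section \<open>The linear equation near the resonance\<close>

lemma periodic_2pi_multiple:
  fixes v :: "real \<Rightarrow> 'a"
  assumes per: "\<And>s. v (s + 2 * pi) = v s"
  shows "v (s + 2 * pi * of_int j) = v s"
proof -
  have nat: "v (s + 2 * pi * of_nat n) = v s" for n s
  proof (induction n)
    case (Suc n)
    then show ?case using per[of "s + 2 * pi * of_nat n"] by (simp add: algebra_simps)
  qed simp
  show ?thesis
  proof (cases j)
    case (neg n)
    then have "real_of_int j = - real (Suc n)" by simp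
    then have "s + 2 * pi * of_int j + 2 * pi * of_nat (Suc n) = s"
      by (simp only:)
    then show ?thesis using nat[of "s + 2 * pi * of_int j" "Suc n"] by metis
  qed (use nat in simp)
qed

lemma periodic_2pi_range:
  fixes v :: "real \<Rightarrow> 'a"
  assumes per: "\<And>s. v (s + 2 * pi) = v s"
  obtains r where "r \<in> {0..2*pi}" "v r = v s"
proof
  define j where "j = - \<lfloor>s / (2 * pi)\<rfloor>"
  show "v (s + 2 * pi * of_int j) = v s"
    by (rule periodic_2pi_multiple[of v]) (rule per)
  have "of_int \<lfloor>s / (2 * pi)\<rfloor> * (2*pi) \<le> s"
    using of_int_floor_le[of "s / (2*pi)"] pos_le_divide_eq[of "2*pi"] by fastforce
  moreover have "s < (of_int \<lfloor>s / (2 * pi)\<rfloor> + 1) * (2*pi)"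
    using floor_correct[of "s / (2*pi)"] pos_divide_less_eq[of "2*pi"] by fastforce
  ultimately show "s + 2 * pi * of_int j \<in> {0..2*pi}"
    by (simp add: j_def algebra_simps)
qed

lemma periodic_attains_sup:
  fixes v :: "real \<Rightarrow> real"
  assumes "continuous_on UNIV v" and per: "\<And>s. v (s + 2 * pi) = v s"
  obtains r where "\<And>s. \<bar>v s\<bar> \<le> \<bar>v r\<bar>"
proof -
  have "\<exists>r\<in>{0..2*pi}. \<forall>s\<in>{0..2*pi}. \<bar>v s\<bar> \<le> \<bar>v r\<bar>"
    by (intro continuous_attains_sup continuous_intros continuous_on_subset[OF assms(1)]) auto
  then obtain r where r: "\<forall>s\<in>{0..2*pi}. \<bar>v s\<bar> \<le> \<bar>v r\<bar>" by blast
  have "\<bar>v s\<bar> \<le> \<bar>v r\<bar>" for s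
    using periodic_2pi_range[of v s] per r by metis
  then show ?thesis using that by blast
qed

text \<open>At a point where \<open>\<bar>y\<bar>\<close> is largest the derivative vanishes, so
  there \<open>\<bar>y\<bar>\<close> equals \<open>\<bar>h\<bar>\<close>. The sign of
  \<open>\<sigma>\<close> does not affect this, which lets the lemma serve both real eigenvalues of
  the quarter shift.\<close>

lemma periodic_linear_ode_bound:
  fixes y h :: "real \<Rightarrow> real"
  assumes d: "\<And>s. (y has_real_derivative h s + \<sigma> * y s) (at s)"
    and per: "\<And>s. y (s + 2 * pi) = y s"
    and h: "\<And>s. \<bar>h s\<bar> \<le> M" and \<sigma>: "\<bar>\<sigma>\<bar> = 1"
  shows "\<bar>y s\<bar> \<le> M"
proof -
  have cont: "continuous_on UNIV y"
    using d by (meson DERIV_isCont continuous_at_imp_continuous_on)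
  obtain r where r: "\<And>s. \<bar>y s\<bar> \<le> \<bar>y r\<bar>"
    using periodic_attains_sup[OF cont per] by blast
  have "h r + \<sigma> * y r = 0"
  proof (cases "y r \<ge> 0")
    case True
    then have "\<And>s. y s \<le> y r" using r by (metis abs_le_D1 abs_of_nonneg)
    then show ?thesis by (intro DERIV_local_max[OF d, of 1]) auto
  next
    case False
    then have "\<And>s. y r \<le> y s" using r by (smt (verit))
    then show ?thesis by (intro DERIV_local_min[OF d, of 1]) auto
  qed
  then have "\<bar>h r\<bar> = \<bar>\<sigma> * y r\<bar>" by linarith
  then have "\<bar>h r\<bar> = \<bar>y r\<bar>" by (simp add: abs_mult \<sigma>)
  then show ?thesis using r[of s] h[of r] by linarith
qed

text \<open>With \<open>S\<close> the shift by \<open>pi/2\<close>, \<open>S\<^sup>4 = 1\<close>, so \<open>v\<close> splits along the eigenvalues of \<open>S\<close>: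
  the components \<open>p\<close>, \<open>q\<close> for \<open>1\<close>, \<open>-1\<close> and \<open>z\<close> for \<open>\<plusminus>\<i>\<close> satisfy uncoupled first-order
  equations, and only the last one is resonant.\<close>

lemma quarter_shift_bound:
  fixes v h :: "real \<Rightarrow> real"
  assumes d: "\<And>s. (v has_real_derivative h s - v (s - pi/2)) (at s)"
    and per: "\<And>s. v (s + 2 * pi) = v s"
    and h: "\<And>s. \<bar>h s\<bar> \<le> M"
    and c1: "fc 1 (\<lambda>s. of_real (v s)) = 0"
  shows "\<bar>v s\<bar> \<le> 15 * M"
proof -
  have d': "((\<lambda>s. v (s - a)) has_real_derivative h (s - a) - v (s - a - pi/2)) (at s)" for s a
  proof -
    have "((\<lambda>s. s - a) has_real_derivative 1) (at s)" by (auto intro!: derivative_eq_intros)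
    from DERIV_chain2[of v "h (s - a) - v (s - a - pi/2)", OF _ this] d show ?thesis by simp
  qed
  have v4: "v (s - 2 * pi) = v s" for s using per[of "s - 2*pi"] by simp
  have d0: "(v has_real_derivative h s - v (s - pi/2)) (at s)"
   and d1: "((\<lambda>s. v (s - pi/2)) has_real_derivative h (s - pi/2) - v (s - pi)) (at s)"
   and d2: "((\<lambda>s. v (s - pi)) has_real_derivative h (s - pi) - v (s - 3*pi/2)) (at s)"
   and d3: "((\<lambda>s. v (s - 3*pi/2)) has_real_derivative h (s - 3*pi/2) - v s) (at s)" for s
    using d[of s] d'[of "pi/2" s] d'[of "pi" s] d'[of "3*pi/2" s] v4[of s]
    by (simp_all add: algebra_simps)
  note ders = d0 d1 d2 d3
  have per': "v (s + 2 * pi - a) = v (s - a)" for s a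
    using per[of "s - a"] by (simp add: algebra_simps)
  have p: "\<bar>v s + v (s - pi/2) + v (s - pi) + v (s - 3*pi/2)\<bar> \<le> 4 * M" for s
  proof (rule periodic_linear_ode_bound[where \<sigma> = "-1" and s = s
          and y = "\<lambda>s. v s + v (s - pi/2) + v (s - pi) + v (s - 3*pi/2)"
          and h = "\<lambda>s. h s + h (s - pi/2) + h (s - pi) + h (s - 3*pi/2)"])
    show "((\<lambda>s. v s + v (s - pi/2) + v (s - pi) + v (s - 3*pi/2)) has_real_derivative
       h s + h (s - pi/2) + h (s - pi) + h (s - 3*pi/2)
        + (-1) * (v s + v (s - pi/2) + v (s - pi) + v (s - 3*pi/2))) (at s)" for s
      by (rule DERIV_cong, (rule DERIV_add ders)+) simp
    show "\<bar>h s + h (s - pi/2) + h (s - pi) + h (s - 3*pi/2)\<bar> \<le> 4 * M" for s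
      using h[of s] h[of "s-pi/2"] h[of "s-pi"] h[of "s-3*pi/2"] by linarith
  qed (simp_all only: per per' abs_minus_cancel abs_one)
  have q: "\<bar>v s - v (s - pi/2) + v (s - pi) - v (s - 3*pi/2)\<bar> \<le> 4 * M" for s
  proof (rule periodic_linear_ode_bound[where \<sigma> = "1" and s = s
          and y = "\<lambda>s. v s - v (s - pi/2) + v (s - pi) - v (s - 3*pi/2)"
          and h = "\<lambda>s. h s - h (s - pi/2) + h (s - pi) - h (s - 3*pi/2)"])
    show "((\<lambda>s. v s - v (s - pi/2) + v (s - pi) - v (s - 3*pi/2)) has_real_derivative
       h s - h (s - pi/2) + h (s - pi) - h (s - 3*pi/2)
        + 1 * (v s - v (s - pi/2) + v (s - pi) - v (s - 3*pi/2))) (at s)" for s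
      by (rule DERIV_cong, (rule DERIV_add DERIV_diff ders)+) simp
    show "\<bar>h s - h (s - pi/2) + h (s - pi) - h (s - 3*pi/2)\<bar> \<le> 4 * M" for s
      using h[of s] h[of "s-pi/2"] h[of "s-pi"] h[of "s-3*pi/2"] by linarith
  qed (simp_all only: per per' abs_minus_cancel abs_one)
  \<comment> \<open>The difference \<open>v s - v (s - pi)\<close> isolates the eigenvalues
    \<open>\<i>\<close> and \<open>- \<i>\<close> of the quarter shift. Pairing it with its own
    quarter shift gives the single complex equation \<open>z' = g + \<i> * z\<close>.\<close>
  define z :: "real \<Rightarrow> complex"
    where "z s = of_real (v s - v (s - pi)) + \<i> * of_real (v (s - pi/2) - v (s - 3*pi/2))" for s
  define g :: "real \<Rightarrow> complex"
    where "g s = of_real (h s - h (s - pi)) + \<i> * of_real (h (s - pi/2) - h (s - 3*pi/2))" for s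
  have dof: "((\<lambda>s. of_real (y s) :: complex) has_vector_derivative of_real y') (at s)"
    if "(y has_real_derivative y') (at s)" for y y' s
    using has_vector_derivative_of_real that by (simp add: has_real_derivative_iff_has_vector_derivative)
  have dz: "(z has_vector_derivative g s + \<i> * z s) (at s)" for s
  proof -
    have "(z has_vector_derivative of_real ((h s - v (s - pi/2)) - (h (s - pi) - v (s - 3*pi/2)))
       + \<i> * of_real ((h (s - pi/2) - v (s - pi)) - (h (s - 3*pi/2) - v s))) (at s)"
      unfolding z_def
      by (intro has_vector_derivative_add has_vector_derivative_mult_right dof DERIV_diff ders)
    then show ?thesis by (simp add: z_def g_def algebra_simps)
  qed
  \<comment> \<open>The integrating factor removes the resonant term but leaves the mean of
    \<open>w\<close> undetermined. The hypothesis on the first Fourier coefficient of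
    \<open>v\<close> makes this mean zero.\<close>
  define w where "w s = z s * cis (- s)" for s
  have dw: "(w has_vector_derivative g s * cis (- s)) (at s)" for s
  proof -
    have "(w has_vector_derivative z s * (\<i> * of_real (- 1) * cis ((- 1) * s)) + (g s + \<i> * z s) * cis ((-1) * s)) (at s)"
      using has_vector_derivative_mult[OF dz has_vector_derivative_cis_linear[of "-1" s UNIV]]
      unfolding w_def by simp
    then show ?thesis by (simp add: algebra_simps)
  qed
  have g: "norm (g s * cis (- s)) \<le> 4 * M" for s
  proof -
    have "norm (g s) \<le> \<bar>h s - h (s - pi)\<bar> + \<bar>h (s - pi/2) - h (s - 3*pi/2)\<bar>"
      unfolding g_def by (rule norm_triangle_le) (simp add: norm_mult flip: of_real_diff)
    also have "\<dots> \<le> 4 * M" using h[of s] h[of "s-pi"] h[of "s-pi/2"] h[of "s - 3*pi/2"] by linarith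
    finally show ?thesis by (simp add: norm_mult)
  qed
  have M: "M \<ge> 0" using h[of 0] by linarith
  have cv: "continuous_on UNIV v"
    using d by (meson DERIV_isCont continuous_at_imp_continuous_on)
  have cw: "continuous_on UNIV w"
    using dw by (meson continuous_at_imp_continuous_on has_vector_derivative_continuous)
  have cva: "continuous_on UNIV (\<lambda>s. complex_of_real (v (s - a)))" for a
    by (intro continuous_intros continuous_on_compose2[OF cv]) auto
  have fs: "fc 1 (\<lambda>s. of_real (v (s - a))) = 0" for a
    using fc_shift[of "\<lambda>s. of_real (v s)" 1 a] c1 per cva[of 0] by simp
  have fd: "fc 1 (\<lambda>s. of_real (v (s - a) - v (s - b))) = 0" for a b
    unfolding of_real_diff by (simp only: fc_diff[OF cva cva] fs diff_self)
  have ca: "continuous_on UNIV (\<lambda>s. complex_of_real (v (s - a) - v (s - b)))" for a b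
    unfolding of_real_diff by (intro continuous_intros cva)
  have "fc 1 z = 0"
    using fc_add[OF ca continuous_on_mult_left[OF ca], of 1 0 pi \<i> "pi/2" "3*pi/2"] fd[of 0 pi]
      fd[of "pi/2" "3*pi/2"]
    unfolding z_def fc_cmult by (simp only: diff_zero mult_zero_right add_0)
  then have w0: "integral {0..2*pi} w = 0" by (simp add: fc_def w_def[abs_def])
  have lip: "norm (w x - w y) \<le> 4 * M * norm (x - y)" for x y
  proof (rule differentiable_bound[of UNIV w "\<lambda>s t. t *\<^sub>R (g s * cis (- s))"])
    show "(w has_derivative (\<lambda>t. t *\<^sub>R (g s * cis (- s)))) (at s within UNIV)" for s
      using dw by (simp add: has_vector_derivative_def)
    show "onorm (\<lambda>t. t *\<^sub>R (g s * cis (- s))) \<le> 4 * M" for s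
    proof (rule onorm_le)
      show "norm (t *\<^sub>R (g s * cis (- s))) \<le> 4 * M * norm t" for t :: real
        using mult_left_mono[OF g[of s], of "\<bar>t\<bar>"] by (simp only: norm_scaleR real_norm_def mult_ac abs_ge_zero)
    qed
  qed auto
  \<comment> \<open>As \<open>w\<close> has mean zero, \<open>w s\<close> is the average of
    \<open>w s - w r\<close> over a period, and each difference is at most \<open>4 * M\<close>
    times the length \<open>2 * pi\<close>.\<close>
  have bw: "norm (w s) \<le> 8 * pi * M" if s: "s \<in> {0..2*pi}" for s
  proof -
    have "norm (integral {0..2*pi} (\<lambda>r. w s - w r)) \<le> (8 * pi * M) * (2*pi - 0)"
    proof (intro integral_bound continuous_intros continuous_on_subset[OF cw] ballI)
      fix r assume "r \<in> {0..2*pi}"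
      then have "4 * M * \<bar>s - r\<bar> \<le> 4 * M * (2*pi)" using s M by (intro mult_left_mono) auto
      then show "norm (w s - w r) \<le> 8 * pi * M" using lip[of s r] by (simp add: mult_ac)
    qed auto
    also have "integral {0..2*pi} (\<lambda>r. w s - w r) = (2*pi) *\<^sub>R w s"
      by (subst integral_diff) (use w0 in \<open>auto intro!: integrable_continuous_interval continuous_on_subset[OF cw]\<close>)
    finally show ?thesis by (simp add: mult_ac)
  qed
  have bv: "\<bar>v s - v (s - pi)\<bar> \<le> 8 * pi * M" for s
  proof -
    obtain r where r: "r \<in> {0..2*pi}" "v r - v (r - pi) = v s - v (s - pi)"
    proof (rule periodic_2pi_range[of "\<lambda>s. v s - v (s - pi)" s])
      show "v (s + 2 * pi) - v (s + 2 * pi - pi) = v s - v (s - pi)" for s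
        by (simp only: per per')
    qed blast
    have "\<bar>Re (z r)\<bar> \<le> norm (z r)" by (rule abs_Re_le_cmod)
    also have "\<dots> = norm (w r)" by (simp add: w_def norm_mult)
    finally show ?thesis using bw[OF r(1)] r(2) by (simp add: z_def)
  qed
  \<comment> \<open>The value \<open>v s\<close> is a quarter of the sum of the two combinations
    bounded in \<open>p\<close> and \<open>q\<close>, plus half of the difference bounded in
    \<open>bv\<close>. This gives \<open>2 * M + 4 * pi * M\<close>, which is below
    \<open>15 * M\<close>.\<close>
  have "pi * M \<le> 3.2 * M" using pi_approx M by (intro mult_right_mono) auto
  then show ?thesis using p[of s] q[of s] bv[of s] by linarith
qed

text \<open>The difference between \<open>\<kappa> * v (s - \<tau>)\<close> and
  \<open>v (s - pi/2)\<close> is counted as forcing in \<open>quarter_shift_bound\<close>. The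
  equation itself bounds the derivative of \<open>v\<close>, so this extra forcing is at most a
  small multiple of the supremum of \<open>v\<close> plus a small multiple of
  \<open>M\<close>.\<close>

lemma perturbed_shift_bound:
  fixes v h :: "real \<Rightarrow> real"
  assumes d: "\<And>s. (v has_real_derivative h s - \<kappa> * v (s - \<tau>)) (at s)"
    and per: "\<And>s. v (s + 2 * pi) = v s"
    and h: "\<And>s. \<bar>h s\<bar> \<le> M"
    and c1: "fc 1 (\<lambda>s. of_real (v s)) = 0"
    and near: "\<bar>\<kappa> - 1\<bar> \<le> 1/100" "\<bar>\<tau> - pi/2\<bar> \<le> 1/100"
  shows "\<bar>v s\<bar> \<le> 30 * M"
proof -
  have cv: "continuous_on UNIV v"
    using d by (meson DERIV_isCont continuous_at_imp_continuous_on)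
  obtain r where r: "\<And>s. \<bar>v s\<bar> \<le> \<bar>v r\<bar>"
    using periodic_attains_sup[of v, OF cv per] by blast
  define V where "V = \<bar>v r\<bar>"
  have V: "\<bar>v s\<bar> \<le> V" for s using r by (simp add: V_def)
  have M: "M \<ge> 0" using h[of 0] by linarith
  have V0: "V \<ge> 0" by (simp add: V_def)
  have d_le: "\<bar>h s - \<kappa> * v (s - \<tau>)\<bar> \<le> M + 101/100 * V" for s
  proof -
    have "\<bar>\<kappa> * v (s - \<tau>)\<bar> \<le> 101/100 * V"
      unfolding abs_mult by (intro mult_mono V) (use near in linarith)+
    then show ?thesis using h[of s] by linarith
  qed
  have lip: "\<bar>v x - v y\<bar> \<le> (M + 101/100 * V) * \<bar>x - y\<bar>" for x y
    using field_differentiable_bound[of UNIV v "\<lambda>s. h s - \<kappa> * v (s - \<tau>)" "M + 101/100 * V" x y] d d_le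
    by simp
  define h' where "h' s = h s + (v (s - pi/2) - v (s - \<tau>)) + (1 - \<kappa>) * v (s - \<tau>)" for s
  have h': "\<bar>h' s\<bar> \<le> M + (M + 101/100 * V) * (1/100) + 1/100 * V" for s
  proof -
    have "\<bar>v (s - pi/2) - v (s - \<tau>)\<bar> \<le> (M + 101/100 * V) * \<bar>\<tau> - pi/2\<bar>"
      using lip[of "s - pi/2" "s - \<tau>"] by simp
    also have "\<dots> \<le> (M + 101/100 * V) * (1/100)"
      using near M V0 by (intro mult_left_mono) auto
    finally have 1: "\<bar>v (s - pi/2) - v (s - \<tau>)\<bar> \<le> (M + 101/100 * V) * (1/100)" .
    have "\<bar>(1 - \<kappa>) * v (s - \<tau>)\<bar> \<le> 1/100 * V"
      unfolding abs_mult by (intro mult_mono V) (use near in linarith)+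
    then show ?thesis using 1 h[of s] unfolding h'_def by linarith
  qed
  have "\<bar>v r\<bar> \<le> 15 * (M + (M + 101/100 * V) * (1/100) + 1/100 * V)"
  proof (rule quarter_shift_bound[OF _ per h' c1])
    show "(v has_real_derivative h' s - v (s - pi/2)) (at s)" for s
      using d[of s] by (simp add: h'_def algebra_simps)
  qed
  \<comment> \<open>On the right, \<open>V\<close> carries the coefficient
    \<open>15 * 0.0201 = 0.3015\<close>, so it can be absorbed on the left.\<close>
  then have "V \<le> 30 * M" using M V0 unfolding V_def by (simp add: algebra_simps)
  then show ?thesis using V[of s] by linarith
qed

section \<open>The first harmonic and the Fourier modes of its powers\<close>

lemma continuous_on_fourier_term:
  "continuous_on UNIV (\<lambda>s. a * cis (of_int j * s))"
  by (intro continuous_intros)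

lemma fc_fourier_term: "fc m (\<lambda>s. a * cis (of_int j * s)) = (if m = j then a else 0)"
  by (simp add: fc_cmult fc_cis)

text \<open>The factor 2 makes \<open>c\<close> itself the Fourier coefficient at mode 1, with
  \<open>cnj c\<close> at mode -1.\<close>

definition fundamental :: "complex \<Rightarrow> real \<Rightarrow> real" where
  "fundamental c s = 2 * Re (c * cis s)"

lemma of_real_fundamental:
  "complex_of_real (fundamental c s) = c * cis (of_int 1 * s) + cnj c * cis (of_int (-1) * s)"
  using complex_add_cnj[of "c * cis s"] by (simp add: fundamental_def cis_cnj)

lemma abs_fundamental_le: "\<bar>fundamental c s\<bar> \<le> 2 * norm c"
  using abs_Re_le_cmod[of "c * cis s"] by (simp add: fundamental_def norm_mult)

lemma continuous_on_fundamental: "continuous_on A (fundamental c)"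
  unfolding fundamental_def [abs_def] by (intro continuous_intros continuous_on_cis)

lemma fundamental_periodic: "fundamental c (s + 2 * pi) = fundamental c s"
  using cis_int_periodic[of 1 s] by (simp add: fundamental_def)

lemma fundamental_has_derivative:
  "(fundamental c has_real_derivative fundamental (\<i> * c) s) (at s)"
  unfolding fundamental_def [abs_def]
proof -
  have "((\<lambda>s. Re (c * cis s)) has_real_derivative Re (c * (\<i> * cis s))) (at s)"
    using bounded_linear.has_vector_derivative[OF bounded_linear_Re
       has_vector_derivative_mult_right[OF has_vector_derivative_cis_linear[of 1 s UNIV]], of c]
    by (simp add: has_real_derivative_iff_has_vector_derivative)
  then have "((\<lambda>s. 2 * Re (c * cis s)) has_real_derivative 2 * Re (c * (\<i> * cis s))) (at s)"
    by (rule DERIV_cmult)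
  then show "((\<lambda>s. 2 * Re (c * cis s)) has_real_derivative 2 * Re (\<i> * c * cis s)) (at s)"
    by (simp only: mult_ac)
qed

lemma fundamental_shift: "fundamental c (s - \<tau>) = fundamental (c * cis (- \<tau>)) s"
  by (simp add: fundamental_def mult.assoc cis_mult)

lemma fundamental_add: "fundamental a s + fundamental b s = fundamental (a + b) s"
  by (simp add: fundamental_def algebra_simps)

lemma fundamental_scale: "r * fundamental a s = fundamental (of_real r * a) s"
  by (simp add: fundamental_def algebra_simps)

text \<open>With \<open>cis s\<close> and \<open>cis (- s)\<close> treated as unknowns of product 1
  this is a polynomial identity. The square contains no mode 1, so the quadratic part of the
  nonlinearity acts on the first mode only at third order.\<close>

lemma of_real_fundamental_power2:
  "complex_of_real ((fundamental c s)\<^sup>2) =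
     c\<^sup>2 * cis (of_int 2 * s) + (of_real (2 * (norm c)\<^sup>2) * cis (of_int 0 * s)
      + (cnj c)\<^sup>2 * cis (of_int (-2) * s))"
proof -
  define e e' where "e = cis s" and "e' = cis (- s)"
  have ee: "e * e' = 1" by (simp add: e_def e'_def cis_mult)
  have e: "cis (of_int 2 * s) = e * e" "cis (of_int (-2) * s) = e' * e'"
    by (simp_all add: e_def e'_def cis_mult)
  have n: "complex_of_real (2 * (norm c)\<^sup>2) = 2 * (c * cnj c)"
    by (simp add: complex_norm_square del: of_real_power)
  have f: "complex_of_real (fundamental c s) = c * e + cnj c * e'"
    using of_real_fundamental[of c s] by (simp add: e_def e'_def)
  show ?thesis
    unfolding of_real_power f e n using ee by simp algebra
qed

lemma of_real_fundamental_power3: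
  "complex_of_real ((fundamental c s)^3) =
     c^3 * cis (of_int 3 * s) + (of_real (3 * (norm c)\<^sup>2) * c * cis (of_int 1 * s)
      + (of_real (3 * (norm c)\<^sup>2) * cnj c * cis (of_int (-1) * s) + (cnj c)^3 * cis (of_int (-3) * s)))"
proof -
  define e e' where "e = cis s" and "e' = cis (- s)"
  have ee: "e * e' = 1" by (simp add: e_def e'_def cis_mult)
  have e: "cis (of_int 3 * s) = e * e * e" "cis (of_int (-3) * s) = e' * e' * e'"
    "cis (of_int 1 * s) = e" "cis (of_int (-1) * s) = e'"
    by (simp_all add: e_def e'_def cis_mult)
  have n: "complex_of_real (3 * (norm c)\<^sup>2) = 3 * (c * cnj c)"
    by (simp add: complex_norm_square del: of_real_power)
  have f: "complex_of_real (fundamental c s) = c * e + cnj c * e'"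
    using of_real_fundamental[of c s] by (simp add: e_def e'_def)
  show ?thesis
    unfolding of_real_power f e n using ee by algebra
qed

lemma fc_fundamental_power2:
  "fc 0 (\<lambda>s. of_real ((fundamental c s)\<^sup>2)) = of_real (2 * (norm c)\<^sup>2)"
  "fc 1 (\<lambda>s. of_real ((fundamental c s)\<^sup>2)) = 0"
  "fc 2 (\<lambda>s. of_real ((fundamental c s)\<^sup>2)) = c\<^sup>2"
  unfolding of_real_fundamental_power2
  by (simp_all only: fc_add continuous_on_fourier_term continuous_on_add fc_fourier_term) simp_all

lemma fc_fundamental_power3:
  "fc 1 (\<lambda>s. of_real ((fundamental c s)^3)) = of_real (3 * (norm c)\<^sup>2) * c"
  unfolding of_real_fundamental_power3
  by (simp only: fc_add continuous_on_fourier_term continuous_on_add fc_fourier_term) simp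

text \<open>Multiplication by \<open>cis s\<close> or \<open>cis (- s)\<close> shifts the Fourier
  index by one, so only the modes 0 and 2 of \<open>v\<close> reach mode 1. This is why the
  expansion closes with the modes 0, 1 and 2.\<close>

lemma fc_fundamental_mult:
  assumes "continuous_on UNIV v"
  shows "fc 1 (\<lambda>s. of_real (fundamental c s * v s)) =
    c * fc 0 (\<lambda>s. of_real (v s)) + cnj c * fc 2 (\<lambda>s. of_real (v s))"
proof -
  have cv: "continuous_on UNIV (\<lambda>s. complex_of_real (v s))"
    by (intro continuous_intros assms)
  have "fc 1 (\<lambda>s. of_real (fundamental c s * v s)) =
    fc 1 (\<lambda>s. c * (cis (of_int 1 * s) * of_real (v s)) + cnj c * (cis (of_int (-1) * s) * of_real (v s)))"
    unfolding of_real_mult of_real_fundamental by (simp only: distrib_right mult.assoc)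
  also have "\<dots> = c * fc (1 - 1) (\<lambda>s. of_real (v s)) + cnj c * fc (1 - (-1)) (\<lambda>s. of_real (v s))"
    by (subst fc_add) (intro continuous_intros cv, intro continuous_intros cv, simp only: fc_cmult fc_mult_cis)
  finally show ?thesis by simp
qed

section \<open>Expansion of a small orbit in its first mode\<close>

text \<open>Here \<open>g\<close> stands for the nonlinear part of the feedback evaluated along the
  orbit. As a given function of time it enters the mode equations linearly, and its size and
  expansion are hypotheses of individual lemmas.\<close>

locale delay_orbit =
  fixes u g :: "real \<Rightarrow> real" and \<kappa> \<tau> :: real
  assumes deriv: "\<And>s. (u has_real_derivative - \<kappa> * (u (s - \<tau>) + g (s - \<tau>))) (at s)"
    and u_periodic: "\<And>s. u (s + 2 * pi) = u s"
    and g_periodic: "\<And>s. g (s + 2 * pi) = g s"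
    and g_cont: "continuous_on UNIV g"
begin

definition mode :: "int \<Rightarrow> complex" where
  "mode m = fc m (\<lambda>s. of_real (u s))"

definition forcing :: "int \<Rightarrow> complex" where
  "forcing m = fc m (\<lambda>s. of_real (g s))"

definition remainder :: "real \<Rightarrow> real" where
  "remainder s = u s - fundamental (mode 1) s"

lemma u_cont: "continuous_on UNIV u"
  using deriv by (meson DERIV_isCont continuous_at_imp_continuous_on)

lemma remainder_cont: "continuous_on UNIV remainder"
  unfolding remainder_def [abs_def] by (intro continuous_intros u_cont continuous_on_fundamental)

lemma of_real_cont:
  "continuous_on UNIV (\<lambda>s. complex_of_real (u s))"
  "continuous_on UNIV (\<lambda>s. complex_of_real (g s))"
  "continuous_on UNIV (\<lambda>s. complex_of_real (remainder s))"
  "continuous_on UNIV (\<lambda>s. complex_of_real (fundamental c s))"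
  by (intro continuous_intros u_cont g_cont remainder_cont continuous_on_fundamental)+

text \<open>Passing to Fourier coefficients turns the derivative into the factor
  \<open>\<i> * of_int m\<close> and the delay into a phase. The relation is exact, without any
  smallness of the orbit.\<close>

lemma mode_eq: "\<i> * of_int m * mode m = - of_real \<kappa> * cis (- of_int m * \<tau>) * (mode m + forcing m)"
proof -
  let ?\<phi> = "\<lambda>s. complex_of_real (u s) + of_real (g s)"
  have "((\<lambda>s. complex_of_real (u s)) has_vector_derivative - of_real \<kappa> * ?\<phi> (s - \<tau>)) (at s)" for s
    using has_vector_derivative_of_real[OF deriv[of s]]
    by simp
  from fc_deriv[OF this, of m]
  have "\<i> * of_int m * mode m = - of_real \<kappa> * fc m (\<lambda>s. ?\<phi> (s - \<tau>))"
    unfolding fc_cmult by (simp only: u_periodic mode_def)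
  also have "fc m (\<lambda>s. ?\<phi> (s - \<tau>)) = cis (- of_int m * \<tau>) * fc m ?\<phi>"
    by (rule fc_shift[where \<phi> = ?\<phi>]) (intro continuous_intros of_real_cont, simp only: u_periodic g_periodic)
  also have "fc m ?\<phi> = mode m + forcing m"
    unfolding mode_def forcing_def by (rule fc_add) (rule of_real_cont)+
  finally show ?thesis by (simp only: mult.assoc)
qed

lemma fc_remainder: "fc m (\<lambda>s. of_real (remainder s)) = mode m - fc m (\<lambda>s. of_real (fundamental (mode 1) s))"
  unfolding remainder_def of_real_diff mode_def
  by (rule fc_diff) (rule of_real_cont)+

lemma fc_remainder_0_1_2:
  "fc 0 (\<lambda>s. of_real (remainder s)) = mode 0"
  "fc 1 (\<lambda>s. of_real (remainder s)) = 0"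
  "fc 2 (\<lambda>s. of_real (remainder s)) = mode 2"
  unfolding fc_remainder of_real_fundamental
  by (simp_all only: fc_add continuous_on_fourier_term fc_fourier_term) simp_all

text \<open>Subtracting the first harmonic removes the resonant modes from the orbit and from the
  forcing at once; what is left falls under \<open>perturbed_shift_bound\<close>.\<close>

lemma remainder_le_forcing:
  assumes g: "\<And>s. \<bar>g s\<bar> \<le> Q" and near: "\<bar>\<kappa> - 1\<bar> \<le> 1/100" "\<bar>\<tau> - pi/2\<bar> \<le> 1/100"
  shows "\<bar>remainder s\<bar> \<le> 91 * Q"
proof -
  \<comment> \<open>This is the first Fourier coefficient of
    \<open>\<kappa> * g (s - \<tau>)\<close>, so \<open>h\<close> below is
    \<open>- \<kappa> * g (s - \<tau>)\<close> with the modes 1 and -1 taken out.\<close>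
  let ?b = "of_real \<kappa> * cis (- \<tau>) * forcing 1"
  define h where "h s = fundamental ?b s - \<kappa> * g (s - \<tau>)" for s
  have Q: "Q \<ge> 0" using g[of 0] by linarith
  have k: "\<bar>\<kappa>\<bar> \<le> 101/100" using near by linarith
  have "norm (forcing 1) \<le> Q"
    unfolding forcing_def by (rule fc_norm_le) (use g of_real_cont in auto)
  then have "\<bar>\<kappa>\<bar> * norm (forcing 1) \<le> 101/100 * Q"
    using k by (intro mult_mono) auto
  then have b: "norm ?b \<le> 101/100 * Q" by (simp add: norm_mult)
  have h: "\<bar>h s\<bar> \<le> 303/100 * Q" for s
  proof -
    have "\<bar>\<kappa> * g (s - \<tau>)\<bar> \<le> 101/100 * Q"
      unfolding abs_mult using k g by (intro mult_mono) auto
    then show ?thesis using abs_fundamental_le[of ?b s] b unfolding h_def by linarith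
  qed
  \<comment> \<open>The removed harmonic contributes up to \<open>2 * norm ?b\<close> and the
    delayed term one further \<open>101/100 * Q\<close>. The product is \<open>90.9 * Q\<close>,
    rounded up to \<open>91 * Q\<close>.\<close>
  have "\<bar>remainder s\<bar> \<le> 30 * (303/100 * Q)"
  proof (rule perturbed_shift_bound[OF _ _ h fc_remainder_0_1_2(2) near])
    fix s
    have "\<i> * mode 1 + of_real \<kappa> * (mode 1 * cis (- \<tau>)) = - ?b"
      using mode_eq[of 1] by (simp add: algebra_simps)
    then have "fundamental (\<i> * mode 1) s + \<kappa> * fundamental (mode 1) (s - \<tau>) = - fundamental ?b s"
      unfolding fundamental_shift fundamental_scale fundamental_add by (simp add: fundamental_def)
    then have e: "- \<kappa> * (u (s - \<tau>) + g (s - \<tau>)) - fundamental (\<i> * mode 1) s = h s - \<kappa> * remainder (s - \<tau>)"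
      by (simp add: h_def remainder_def algebra_simps)
    show "(remainder has_real_derivative h s - \<kappa> * remainder (s - \<tau>)) (at s)"
      using DERIV_diff[OF deriv[of s] fundamental_has_derivative[of "mode 1" s]]
      unfolding e by (simp only: remainder_def [abs_def])
    show "remainder (s + 2 * pi) = remainder s"
      by (simp add: remainder_def u_periodic fundamental_periodic)
  qed
  then show ?thesis using Q by linarith
qed

text \<open>For quadratic \<open>g\<close> the maximum \<open>U\<close> satisfies
  \<open>U \<le> 2 * a + 91 * (G * U\<^sup>2)\<close>. The a priori bound \<open>S\<close> makes the
  last term at most \<open>U / 2\<close>, whence \<open>U \<le> 4 * a\<close>; the constant 1456 is
  \<open>91 * 16\<close>.\<close>

lemma amplitude_bound:
  assumes g: "\<And>s. \<bar>g s\<bar> \<le> G * (u s)\<^sup>2" and near: "\<bar>\<kappa> - 1\<bar> \<le> 1/100" "\<bar>\<tau> - pi/2\<bar> \<le> 1/100"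
    and S: "\<And>s. \<bar>u s\<bar> \<le> S" and small: "182 * G * S \<le> 1" and G: "G \<ge> 0"
  shows "\<bar>u s\<bar> \<le> 4 * norm (mode 1)"
    and "\<bar>remainder s\<bar> \<le> 1456 * G * (norm (mode 1))\<^sup>2"
proof -
  define a where "a = norm (mode 1)"
  obtain r where r: "\<And>s. \<bar>u s\<bar> \<le> \<bar>u r\<bar>"
    using periodic_attains_sup[of u, OF u_cont u_periodic] by blast
  define U where "U = \<bar>u r\<bar>"
  have "(u s)\<^sup>2 \<le> U\<^sup>2" for s using r[of s] unfolding U_def by (simp add: abs_le_square_iff)
  then have "\<bar>g s\<bar> \<le> G * U\<^sup>2" for s
    using g[of s] mult_left_mono[OF _ G] by (meson order_trans)
  from remainder_le_forcing[OF this near]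
  have rem: "\<bar>remainder s\<bar> \<le> 91 * (G * U\<^sup>2)" for s .
  have "G * U \<le> G * S" unfolding U_def by (intro mult_left_mono S G)
  then have "(182 * (G * U)) * U \<le> 1 * U" using small by (intro mult_right_mono) (auto simp: U_def)
  moreover have "U \<le> 2 * a + 91 * (G * U\<^sup>2)"
    using rem[of r] abs_fundamental_le[of "mode 1" r] unfolding U_def remainder_def a_def by linarith
  ultimately have Ua: "U \<le> 4 * a" by (simp add: power2_eq_square algebra_simps)
  then show "\<bar>u s\<bar> \<le> 4 * norm (mode 1)" using r[of s] unfolding a_def U_def by linarith
  have "U\<^sup>2 \<le> (4 * a)\<^sup>2" using Ua by (intro power_mono) (auto simp: U_def)
  then have "G * U\<^sup>2 \<le> G * (4 * a)\<^sup>2" using G by (intro mult_left_mono)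
  then have "91 * (G * U\<^sup>2) \<le> 1456 * G * a\<^sup>2" by (simp add: power_mult_distrib)
  with rem[of s] show "\<bar>remainder s\<bar> \<le> 1456 * G * (norm (mode 1))\<^sup>2" unfolding a_def by linarith
qed

text \<open>In \<open>u = w + remainder\<close> the harmonic \<open>w\<close> has order
  \<open>a\<close> and the remainder order \<open>a\<^sup>2\<close>. Modes 0 and 2 of
  \<open>g\<close> are given to leading order by \<open>B * w\<^sup>2\<close>. This square has no
  mode 1, so there the leading terms are the cross term \<open>2 * B * w * remainder\<close> and
  \<open>C * w^3\<close>, both of third order.\<close>

lemma forcing_expansion:
  assumes u: "\<And>s. \<bar>u s\<bar> \<le> 4 * norm (mode 1)"
    and v: "\<And>s. \<bar>remainder s\<bar> \<le> K * (norm (mode 1))\<^sup>2" and K: "K \<ge> 0"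
    and g: "\<And>s. \<bar>g s - (B * (u s)\<^sup>2 + C * (u s)^3)\<bar> \<le> \<epsilon> * (norm (mode 1))^3"
    and small: "norm (mode 1) \<le> 1"
  defines "L \<equiv> \<bar>B\<bar> * (4 * K + K\<^sup>2) + 64 * \<bar>C\<bar> + \<epsilon>"
  shows "norm (forcing 0 - of_real (2 * B * (norm (mode 1))\<^sup>2)) \<le> L * (norm (mode 1))^3"
    and "norm (forcing 2 - of_real B * (mode 1)\<^sup>2) \<le> L * (norm (mode 1))^3"
    and "norm (forcing 1 - (of_real (2 * B) * (mode 1 * mode 0 + cnj (mode 1) * mode 2)
           + of_real (3 * C * (norm (mode 1))\<^sup>2) * mode 1))
         \<le> (\<bar>B\<bar> * K\<^sup>2 + 28 * \<bar>C\<bar> * K) * (norm (mode 1))^4 + \<epsilon> * (norm (mode 1))^3"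
proof -
  define a where "a = norm (mode 1)"
  define w where "w = fundamental (mode 1)"
  define r where "r s = g s - (B * (u s)\<^sup>2 + C * (u s)^3)" for s
  note u = u[folded a_def] and v = v[folded a_def] and g = g[folded a_def r_def]
  have a: "0 \<le> a" "a \<le> 1" using small by (auto simp: a_def)
  have uw: "u s = w s + remainder s" for s by (simp add: remainder_def w_def)
  have w: "\<bar>w s\<bar> \<le> 2 * a" for s unfolding w_def a_def by (rule abs_fundamental_le)
  have a43: "a^4 \<le> a^3" using a by (intro power_decreasing) auto
  have v2: "(remainder s)\<^sup>2 \<le> K\<^sup>2 * a^4" for s
    using power_mono[OF v[of s], of 2] by (simp add: power_mult_distrib flip: power_mult)
  have wv: "\<bar>w s * remainder s\<bar> \<le> 2 * K * a^3" for s
  proof -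
    have "\<bar>w s\<bar> * \<bar>remainder s\<bar> \<le> (2 * a) * (K * a\<^sup>2)" using a by (intro mult_mono w v) auto
    also have "\<dots> = 2 * K * a^3" by algebra
    finally show ?thesis by (simp only: abs_mult)
  qed
  have u3: "\<bar>u s\<bar>^3 \<le> 64 * a^3" for s
    using power_mono[OF u[of s], of 3] by (simp add: power_mult_distrib)
  have cont: "continuous_on UNIV w" "continuous_on UNIV remainder" "continuous_on UNIV u" "continuous_on UNIV g"
    by (auto simp: w_def continuous_on_fundamental remainder_cont u_cont g_cont)
  have cr: "continuous_on UNIV (\<lambda>s. complex_of_real (\<phi> s))" if "continuous_on UNIV \<phi>" for \<phi> :: "real \<Rightarrow> real"
    using that by (rule continuous_on_of_real)
  \<comment> \<open>What \<open>g\<close> retains beyond \<open>B * w\<^sup>2\<close>; all of it is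
    of third order.\<close>
  define q where "q s = B * (2 * (w s * remainder s) + (remainder s)\<^sup>2) + (C * (u s)^3 + r s)" for s
  have u2: "(u s)\<^sup>2 = (w s)\<^sup>2 + 2 * (w s * remainder s) + (remainder s)\<^sup>2" for s
    unfolding uw[of s] power2_sum by simp
  have gq: "g s = B * (w s)\<^sup>2 + q s" for s
    unfolding q_def r_def u2[of s] distrib_left by simp
  have q: "\<bar>q s\<bar> \<le> L * a^3" for s
  proof -
    have "K\<^sup>2 * a^4 \<le> K\<^sup>2 * a^3" by (intro mult_left_mono a43) auto
    then have "\<bar>2 * (w s * remainder s) + (remainder s)\<^sup>2\<bar> \<le> (4 * K + K\<^sup>2) * a^3"
      using wv[of s] v2[of s] zero_le_power2[of "remainder s"] by (simp only: distrib_right)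
    then have "\<bar>B * (2 * (w s * remainder s) + (remainder s)\<^sup>2)\<bar> \<le> \<bar>B\<bar> * ((4 * K + K\<^sup>2) * a^3)"
      unfolding abs_mult by (intro mult_left_mono) auto
    moreover have "\<bar>C * (u s)^3\<bar> \<le> \<bar>C\<bar> * (64 * a^3)"
      unfolding abs_mult power_abs by (intro mult_left_mono u3) auto
    ultimately have "\<bar>q s\<bar> \<le> \<bar>B\<bar> * ((4 * K + K\<^sup>2) * a^3) + \<bar>C\<bar> * (64 * a^3) + \<epsilon> * a^3"
      using g[of s] unfolding q_def by linarith
    then show ?thesis unfolding L_def by (simp only: distrib_right distrib_left mult_ac)
  qed
  have cq: "continuous_on UNIV q"
    unfolding q_def [abs_def] r_def by (intro continuous_intros cont)
  have "forcing m = of_real B * fc m (\<lambda>s. of_real ((w s)\<^sup>2)) + fc m (\<lambda>s. of_real (q s))" for m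
  proof -
    have "forcing m = fc m (\<lambda>s. of_real B * of_real ((w s)\<^sup>2) + of_real (q s))"
      unfolding forcing_def gq by (simp only: of_real_add of_real_mult)
    also have "\<dots> = of_real B * fc m (\<lambda>s. of_real ((w s)\<^sup>2)) + fc m (\<lambda>s. of_real (q s))"
      by (subst fc_add) (intro continuous_intros cr cont cq, intro cr cq, simp only: fc_cmult)
    finally show ?thesis .
  qed
  moreover have "norm (fc m (\<lambda>s. of_real (q s))) \<le> L * a^3" for m
    by (rule fc_norm_le[OF cr[OF cq]]) (use q in simp)
  ultimately have fq: "norm (forcing m - of_real B * fc m (\<lambda>s. of_real ((w s)\<^sup>2))) \<le> L * a^3" for m
    by simp
  show "norm (forcing 0 - of_real (2 * B * (norm (mode 1))\<^sup>2)) \<le> L * (norm (mode 1))^3"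
    using fq[of 0] unfolding w_def fc_fundamental_power2 a_def by (simp add: mult_ac)
  show "norm (forcing 2 - of_real B * (mode 1)\<^sup>2) \<le> L * (norm (mode 1))^3"
    using fq[of 2] unfolding w_def fc_fundamental_power2 a_def by simp
  \<comment> \<open>What \<open>g\<close> retains once the cross term and \<open>C * w^3\<close> are
    also split off: fourth order, apart from the error \<open>r\<close> of size
    \<open>\<epsilon> * a^3\<close>.\<close>
  define p where "p s = B * (remainder s)\<^sup>2 + (C * ((u s)^3 - (w s)^3) + r s)" for s
  have gp: "g s = B * (w s)\<^sup>2 + (2 * B * (w s * remainder s) + (C * (w s)^3 + p s))" for s
    unfolding p_def r_def u2[of s] distrib_left right_diff_distrib by simp
  have cp: "continuous_on UNIV p"
    unfolding p_def [abs_def] r_def by (intro continuous_intros cont)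
  have p: "\<bar>p s\<bar> \<le> (\<bar>B\<bar> * K\<^sup>2 + 28 * \<bar>C\<bar> * K) * a^4 + \<epsilon> * a^3" for s
  proof -
    have 1: "\<bar>B * (remainder s)\<^sup>2\<bar> \<le> \<bar>B\<bar> * (K\<^sup>2 * a^4)"
      unfolding abs_mult using v2[of s] by (intro mult_left_mono) auto
    \<comment> \<open>The cofactor of \<open>u s - w s\<close> in the difference of cubes; 28 is
      \<open>16 + 8 + 4\<close>, from \<open>\<bar>u s\<bar> \<le> 4 * a\<close> and
      \<open>\<bar>w s\<bar> \<le> 2 * a\<close>.\<close>
    have "\<bar>(u s)\<^sup>2 + u s * w s + (w s)\<^sup>2\<bar> \<le> 28 * a\<^sup>2"
    proof -
      have "(u s)\<^sup>2 \<le> 16 * a\<^sup>2" using power_mono[OF u[of s], of 2] by (simp add: power_mult_distrib)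
      moreover have "(w s)\<^sup>2 \<le> 4 * a\<^sup>2" using power_mono[OF w[of s], of 2] by (simp add: power_mult_distrib)
      moreover have "\<bar>u s * w s\<bar> \<le> 8 * a\<^sup>2"
        using mult_mono[OF u[of s] w[of s]] a by (simp add: abs_mult power2_eq_square)
      ultimately show ?thesis using zero_le_power2[of "u s"] zero_le_power2[of "w s"] by linarith
    qed
    then have "\<bar>remainder s\<bar> * \<bar>(u s)\<^sup>2 + u s * w s + (w s)\<^sup>2\<bar> \<le> (K * a\<^sup>2) * (28 * a\<^sup>2)"
      using v[of s] K by (intro mult_mono) auto
    moreover have "(u s)^3 - (w s)^3 = remainder s * ((u s)\<^sup>2 + u s * w s + (w s)\<^sup>2)"
    proof -
      have "x^3 - y^3 = (x - y) * (x\<^sup>2 + x * y + y\<^sup>2)" for x y :: real by algebra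
      from this[of "u s" "w s"] show ?thesis by (simp add: uw[of s])
    qed
    ultimately have "\<bar>(u s)^3 - (w s)^3\<bar> \<le> (K * a\<^sup>2) * (28 * a\<^sup>2)" by (simp only: abs_mult)
    then have "\<bar>C * ((u s)^3 - (w s)^3)\<bar> \<le> \<bar>C\<bar> * ((K * a\<^sup>2) * (28 * a\<^sup>2))"
      unfolding abs_mult[of C] by (intro mult_left_mono) auto
    also have "\<dots> = 28 * \<bar>C\<bar> * K * a^4" by (simp add: power2_eq_square power4_eq_xxxx)
    finally have "\<bar>p s\<bar> \<le> \<bar>B\<bar> * (K\<^sup>2 * a^4) + 28 * \<bar>C\<bar> * K * a^4 + \<epsilon> * a^3"
      using 1 g[of s] unfolding p_def by linarith
    then show ?thesis by (simp only: distrib_right mult.assoc)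
  qed
  have "forcing 1 = fc 1 (\<lambda>s. of_real B * of_real ((w s)\<^sup>2) + (of_real (2 * B) * of_real (w s * remainder s)
      + (of_real C * of_real ((w s)^3) + of_real (p s))))"
    unfolding forcing_def gp by (simp only: of_real_add of_real_mult)
  also have "\<dots> = of_real B * fc 1 (\<lambda>s. of_real ((w s)\<^sup>2)) + (of_real (2 * B) * fc 1 (\<lambda>s. of_real (w s * remainder s))
      + (of_real C * fc 1 (\<lambda>s. of_real ((w s)^3)) + fc 1 (\<lambda>s. of_real (p s))))"
  proof -
    have c: "continuous_on UNIV (\<lambda>s. complex_of_real B * of_real ((w s)\<^sup>2))"
      "continuous_on UNIV (\<lambda>s. complex_of_real (2 * B) * of_real (w s * remainder s))"
      "continuous_on UNIV (\<lambda>s. complex_of_real C * of_real ((w s)^3))"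
      "continuous_on UNIV (\<lambda>s. complex_of_real (p s))"
      by (intro continuous_intros cont cp cr)+
    show ?thesis by (simp only: fc_add c continuous_on_add fc_cmult)
  qed
  also have "\<dots> = (of_real (2 * B) * (mode 1 * mode 0 + cnj (mode 1) * mode 2)
           + of_real (3 * C * a\<^sup>2) * mode 1) + fc 1 (\<lambda>s. of_real (p s))"
    unfolding w_def fc_fundamental_power2 fc_fundamental_power3 fc_fundamental_mult[OF remainder_cont]
      fc_remainder_0_1_2 a_def by (simp add: mult_ac)
  finally have "norm (forcing 1 - (of_real (2 * B) * (mode 1 * mode 0 + cnj (mode 1) * mode 2)
           + of_real (3 * C * a\<^sup>2) * mode 1)) = norm (fc 1 (\<lambda>s. of_real (p s)))"
    by simp
  also have "\<dots> \<le> (\<bar>B\<bar> * K\<^sup>2 + 28 * \<bar>C\<bar> * K) * a^4 + \<epsilon> * a^3"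
    by (rule fc_norm_le[OF cr[OF cp]]) (use p in simp)
  finally show "norm (forcing 1 - (of_real (2 * B) * (mode 1 * mode 0 + cnj (mode 1) * mode 2)
           + of_real (3 * C * (norm (mode 1))\<^sup>2) * mode 1))
         \<le> (\<bar>B\<bar> * K\<^sup>2 + 28 * \<bar>C\<bar> * K) * (norm (mode 1))^4 + \<epsilon> * (norm (mode 1))^3"
    unfolding a_def .
qed

end

section \<open>Limits of the mode equations along a family of small orbits\<close>

text \<open>Turns little-o estimates with explicit \<open>\<epsilon>\<close> into limits. The
  constants \<open>K\<close> and \<open>M\<close> are fixed before \<open>\<epsilon>\<close>, so the
  bound can be made smaller than any given number.\<close>

lemma tendsto_zero_if_eventually_le_all:
  fixes h :: "'a \<Rightarrow> 'b::real_normed_vector"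
  assumes a: "(a \<longlongrightarrow> (0::real)) F"
    and le: "\<And>\<epsilon>. \<epsilon> > 0 \<Longrightarrow> \<forall>\<^sub>F x in F. norm (h x) \<le> K * a x + M * \<epsilon>"
  shows "(h \<longlongrightarrow> 0) F"
proof (rule tendstoI)
  fix e :: real assume e: "e > 0"
  define \<epsilon> where "\<epsilon> = e / (2 * (\<bar>M\<bar> + 1))"
  have \<epsilon>: "\<epsilon> > 0" using e by (simp add: \<epsilon>_def)
  have "M * \<epsilon> \<le> (\<bar>M\<bar> + 1) * \<epsilon>" using \<epsilon> by (intro mult_right_mono) auto
  also have "\<dots> = e / 2"
  proof -
    have "\<bar>M\<bar> + 1 \<noteq> 0" by linarith
    then show ?thesis unfolding \<epsilon>_def by (simp add: divide_simps)
  qed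
  finally have M: "M * \<epsilon> \<le> e / 2" .
  have "((\<lambda>x. K * a x) \<longlongrightarrow> K * 0) F" by (intro tendsto_intros a)
  then have "\<forall>\<^sub>F x in F. K * a x < e / 2" using e by (intro order_tendstoD) auto
  with le[OF \<epsilon>] show "\<forall>\<^sub>F x in F. dist (h x) 0 < e"
    by eventually_elim (use M in \<open>auto simp: dist_norm\<close>)
qed

text \<open>The equations of modes 0 and 2 express these modes through \<open>c\<close>:
  asymptotically \<open>-2 * B\<close> times \<open>\<bar>c\<bar>\<^sup>2\<close>, and
  \<open>B / (2 * \<i> - 1)\<close> times \<open>c\<^sup>2\<close>. Inserted into the equation of
  mode 1, divided by \<open>c\<close> and \<open>\<bar>c\<bar>\<^sup>2\<close>, they give the stated
  limit.\<close>

lemma delay_orbit_normal_form: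
  fixes u :: "'a \<Rightarrow> real \<Rightarrow> real" and \<kappa> \<tau> :: "'a \<Rightarrow> real" and G :: "real \<Rightarrow> real" and B C :: real
  defines "c \<equiv> \<lambda>x. delay_orbit.mode (u x) 1"
  assumes orbit: "\<forall>\<^sub>F x in F. delay_orbit (u x) (\<lambda>s. G (u x s)) (\<kappa> x) (\<tau> x)"
    and nontrivial: "\<forall>\<^sub>F x in F. \<exists>s. u x s \<noteq> 0"
    and \<kappa>: "(\<kappa> \<longlongrightarrow> 1) F" and \<tau>: "(\<tau> \<longlongrightarrow> pi/2) F"
    and small: "\<And>\<epsilon>. \<epsilon> > 0 \<Longrightarrow> \<forall>\<^sub>F x in F. \<forall>s. \<bar>u x s\<bar> < \<epsilon>"
    and G: "\<And>\<epsilon>. \<epsilon> > 0 \<Longrightarrow> \<exists>d>0. \<forall>y. \<bar>y\<bar> < d \<longrightarrow> \<bar>G y - (B * y\<^sup>2 + C * y^3)\<bar> \<le> \<epsilon> * \<bar>y\<bar>^3"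
  shows "\<forall>\<^sub>F x in F. c x \<noteq> 0"
    and "((\<lambda>x. norm (c x)) \<longlongrightarrow> 0) F"
    and "((\<lambda>x. (1 + \<i> * cis (\<tau> x) / of_real (\<kappa> x)) / of_real ((norm (c x))\<^sup>2)) \<longlongrightarrow>
      Complex (22/5 * B\<^sup>2 - 3 * C) (4/5 * B\<^sup>2)) F"
proof -
  define m where "m x = delay_orbit.mode (u x)" for x
  define N where "N x = delay_orbit.forcing (\<lambda>s. G (u x s))" for x
  define a where "a x = norm (c x)" for x
  define G0 where "G0 = \<bar>B\<bar> + \<bar>C\<bar> + 1"
  define K where "K = 1456 * G0"
  have G0: "G0 \<ge> 0" and K0: "K \<ge> 0" by (simp_all add: G0_def K_def)
  have cm: "c x = m x 1" for x by (simp add: c_def m_def)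
  have near: "\<forall>\<^sub>F x in F. \<bar>\<kappa> x - 1\<bar> \<le> 1/100" "\<forall>\<^sub>F x in F. \<bar>\<tau> x - pi/2\<bar> \<le> 1/100"
    using tendstoD[OF \<kappa>, of "1/100"] tendstoD[OF \<tau>, of "1/100"]
    by (simp_all add: dist_real_def eventually_mono)
  obtain d where d: "d > 0" "\<And>y. \<bar>y\<bar> < d \<Longrightarrow> \<bar>G y - (B * y\<^sup>2 + C * y^3)\<bar> \<le> 1 * \<bar>y\<bar>^3"
    using G[of 1] by auto
  have Gq: "\<bar>G y\<bar> \<le> G0 * y\<^sup>2" if "\<bar>y\<bar> < d" "\<bar>y\<bar> < 1" for y
  proof -
    have y3: "\<bar>y\<bar>^3 \<le> y\<^sup>2"
      using power_decreasing[of 2 3 "\<bar>y\<bar>"] that by simp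
    have "\<bar>B * y\<^sup>2\<bar> = \<bar>B\<bar> * y\<^sup>2" by (simp add: abs_mult)
    moreover have "\<bar>C * y^3\<bar> \<le> \<bar>C\<bar> * y\<^sup>2"
      unfolding abs_mult power_abs by (intro mult_left_mono y3) auto
    ultimately have "\<bar>G y\<bar> \<le> \<bar>B\<bar> * y\<^sup>2 + \<bar>C\<bar> * y\<^sup>2 + y\<^sup>2"
      using d(2)[OF that(1)] y3 by linarith
    then show ?thesis by (simp add: G0_def algebra_simps)
  qed
  \<comment> \<open>Small enough for the quadratic bound \<open>Gq\<close> to apply and for the
    smallness condition of \<open>amplitude_bound\<close> to hold.\<close>
  define S where "S = min (min d 1) (1 / (182 * (G0 + 1)))"
  have S: "S > 0" using d G0 by (auto simp: S_def)
  have GS: "182 * G0 * S \<le> 1"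
  proof -
    have "182 * G0 * S \<le> 182 * G0 * (1 / (182 * (G0 + 1)))"
      using G0 by (intro mult_left_mono) (auto simp: S_def)
    also have "\<dots> \<le> 1" using G0 by (simp add: divide_simps)
    finally show ?thesis .
  qed
  have bounds: "\<forall>\<^sub>F x in F. (\<forall>s. \<bar>u x s\<bar> \<le> 4 * a x) \<and> (\<forall>s. \<bar>delay_orbit.remainder (u x) s\<bar> \<le> K * (a x)\<^sup>2)"
    using orbit near small[OF S]
  proof eventually_elim
    case (elim x)
    interpret delay_orbit "u x" "\<lambda>s. G (u x s)" "\<kappa> x" "\<tau> x" by (rule elim)
    have b: "\<bar>u x s\<bar> \<le> S" "\<bar>u x s\<bar> < d" "\<bar>u x s\<bar> < 1" for s
      using elim(4)[rule_format, of s] by (auto simp: S_def)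
    show ?case
      using amplitude_bound[OF Gq[OF b(2,3)] elim(2,3) b(1) GS G0] unfolding a_def c_def K_def by blast
  qed
  show ne: "\<forall>\<^sub>F x in F. c x \<noteq> 0"
    using bounds nontrivial
  proof eventually_elim
    case (elim x)
    then obtain s where "u x s \<noteq> 0" "\<bar>u x s\<bar> \<le> 4 * a x" by blast
    then show ?case by (auto simp: a_def)
  qed
  \<comment> \<open>A Fourier coefficient is at most the supremum of the function, so
    \<open>a\<close> inherits the smallness of the orbit.\<close>
  have a_small: "\<forall>\<^sub>F x in F. a x \<le> e" if e: "e > 0" for e
    using orbit small[OF e]
  proof eventually_elim
    case (elim x)
    interpret delay_orbit "u x" "\<lambda>s. G (u x s)" "\<kappa> x" "\<tau> x" by (rule elim)
    show ?case unfolding a_def c_def mode_def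
      by (rule fc_norm_le) (use elim(2) of_real_cont in \<open>auto intro: less_imp_le\<close>)
  qed
  have a0: "(a \<longlongrightarrow> 0) F"
  proof (rule tendstoI)
    fix e :: real assume "e > 0"
    then have "\<forall>\<^sub>F x in F. a x \<le> e / 2" by (intro a_small) auto
    then show "\<forall>\<^sub>F x in F. dist (a x) 0 < e"
      by eventually_elim (use \<open>e > 0\<close> in \<open>auto simp: a_def\<close>)
  qed
  then show "((\<lambda>x. norm (c x)) \<longlongrightarrow> 0) F" by (simp only: a_def [abs_def])
  have near_cubic: "\<forall>\<^sub>F x in F. \<forall>s. \<bar>G (u x s) - (B * (u x s)\<^sup>2 + C * (u x s)^3)\<bar> \<le> 64 * \<epsilon> * (a x)^3"
    if \<epsilon>: "\<epsilon> > 0" for \<epsilon>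
  proof -
    obtain d where d: "d > 0" "\<And>y. \<bar>y\<bar> < d \<Longrightarrow> \<bar>G y - (B * y\<^sup>2 + C * y^3)\<bar> \<le> \<epsilon> * \<bar>y\<bar>^3"
      using G[OF \<epsilon>] by auto
    show ?thesis using small[OF d(1)] bounds
    proof eventually_elim
      case (elim x)
      show ?case
      proof
        fix s
        have "\<bar>u x s\<bar>^3 \<le> (4 * a x)^3" using elim by (intro power_mono) auto
        then have "\<epsilon> * \<bar>u x s\<bar>^3 \<le> \<epsilon> * (64 * (a x)^3)"
          using \<epsilon> by (intro mult_left_mono) (auto simp: power_mult_distrib)
        then show "\<bar>G (u x s) - (B * (u x s)\<^sup>2 + C * (u x s)^3)\<bar> \<le> 64 * \<epsilon> * (a x)^3"
          using d(2)[of "u x s"] elim(1)[rule_format, of s] by linarith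
      qed
    qed
  qed
  define L where "L = \<bar>B\<bar> * (4 * K + K\<^sup>2) + 64 * \<bar>C\<bar>"
  define K3 where "K3 = \<bar>B\<bar> * K\<^sup>2 + 28 * \<bar>C\<bar> * K"
  define R where "R x = N x 1 - (of_real (2 * B) * (c x * m x 0 + cnj (c x) * m x 2)
           + of_real (3 * C * (a x)\<^sup>2) * c x)" for x
  have forcing: "\<forall>\<^sub>F x in F. norm (N x 0 - of_real (2 * B * (a x)\<^sup>2)) \<le> (L + 64 * \<epsilon>) * (a x)^3
      \<and> norm (N x 2 - of_real B * (c x)\<^sup>2) \<le> (L + 64 * \<epsilon>) * (a x)^3
      \<and> norm (R x) \<le> K3 * (a x)^4 + 64 * \<epsilon> * (a x)^3" if \<epsilon>: "\<epsilon> > 0" for \<epsilon>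
    using orbit bounds near_cubic[OF \<epsilon>] a_small[of 1, simplified]
  proof eventually_elim
    case (elim x)
    interpret delay_orbit "u x" "\<lambda>s. G (u x s)" "\<kappa> x" "\<tau> x" by (rule elim)
    note e = forcing_expansion[OF elim(2)[THEN conjunct1, rule_format, unfolded a_def c_def]
        elim(2)[THEN conjunct2, rule_format, unfolded a_def c_def] K0
        elim(3)[rule_format, unfolded a_def c_def] elim(4)[unfolded a_def c_def]]
    then show ?case unfolding a_def R_def cm m_def N_def L_def K3_def by blast
  qed
  have scaled: "norm (z / of_real (t\<^sup>2)) \<le> l * t" if "norm z \<le> l * t^3" "t > 0" for z :: complex and l t :: real
  proof -
    have "norm (z / of_real (t\<^sup>2)) = norm z / t\<^sup>2" by (simp add: norm_divide norm_power)
    also have "\<dots> \<le> l * t^3 / t\<^sup>2" using that by (intro divide_right_mono) auto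
    also have "\<dots> = l * t" using that by (simp add: power2_eq_square power3_eq_cube)
    finally show ?thesis .
  qed
  have m0: "((\<lambda>x. m x 0 / of_real ((a x)\<^sup>2)) \<longlongrightarrow> of_real (- 2 * B)) F"
  proof -
    \<comment> \<open>The error is of order \<open>a\<close>, so the cubic estimate at
      \<open>\<epsilon> = 1\<close> suffices; the summand \<open>0 * e\<close> only gives the bound
      the shape of \<open>tendsto_zero_if_eventually_le_all\<close>.\<close>
    have "\<forall>\<^sub>F x in F. norm (m x 0 / of_real ((a x)\<^sup>2) - of_real (- 2 * B)) \<le> (L + 64 * 1) * a x + 0 * e" for e :: real
      using orbit ne near(1) forcing[OF zero_less_one]
    proof eventually_elim
      case (elim x)
      interpret delay_orbit "u x" "\<lambda>s. G (u x s)" "\<kappa> x" "\<tau> x" by (rule elim)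
      have a: "a x > 0" using elim(2) by (simp add: a_def)
      have "\<kappa> x \<noteq> 0" using elim(3) by auto
      then have "m x 0 = - N x 0" using mode_eq[of 0] unfolding m_def N_def
        by (simp add: add_eq_0_iff2)
      then have "m x 0 / of_real ((a x)\<^sup>2) - of_real (- 2 * B) = - (N x 0 - of_real (2 * B * (a x)\<^sup>2)) / of_real ((a x)\<^sup>2)"
        using a by (simp add: field_simps)
      moreover have "norm (\<dots>) \<le> (L + 64 * 1) * a x"
        by (rule scaled[OF _ a]) (use elim(4) in \<open>simp only: norm_minus_cancel\<close>)
      ultimately show ?case by simp
    qed
    then have "((\<lambda>x. m x 0 / of_real ((a x)\<^sup>2) - of_real (- 2 * B)) \<longlongrightarrow> 0) F"
      by (rule tendsto_zero_if_eventually_le_all[OF a0])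
    then show ?thesis by (rule LIM_zero_cancel)
  qed
  have N2: "((\<lambda>x. N x 2 / (c x)\<^sup>2) \<longlongrightarrow> of_real B) F"
  proof -
    have "\<forall>\<^sub>F x in F. norm (N x 2 / (c x)\<^sup>2 - of_real B) \<le> (L + 64 * 1) * a x + 0 * e" for e :: real
      using ne forcing[OF zero_less_one]
    proof eventually_elim
      case (elim x)
      have a: "a x > 0" using elim(1) by (simp add: a_def)
      have "norm (N x 2 / (c x)\<^sup>2 - of_real B) = norm ((N x 2 - of_real B * (c x)\<^sup>2) / (c x)\<^sup>2)"
        using elim(1) by (simp add: diff_divide_distrib)
      also have "\<dots> = norm ((N x 2 - of_real B * (c x)\<^sup>2) / of_real ((a x)\<^sup>2))"
        by (simp add: norm_divide norm_power a_def)
      also have "\<dots> \<le> (L + 64 * 1) * a x" by (rule scaled[OF _ a]) (use elim(2) in blast)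
      finally show ?case by simp
    qed
    then have "((\<lambda>x. N x 2 / (c x)\<^sup>2 - of_real B) \<longlongrightarrow> 0) F"
      by (rule tendsto_zero_if_eventually_le_all[OF a0])
    then show ?thesis by (rule LIM_zero_cancel)
  qed
  have R: "((\<lambda>x. R x / (c x * of_real ((a x)\<^sup>2))) \<longlongrightarrow> 0) F"
  proof (rule tendsto_zero_if_eventually_le_all[OF a0])
    fix \<epsilon> :: real assume "\<epsilon> > 0"
    from ne forcing[OF this] show "\<forall>\<^sub>F x in F. norm (R x / (c x * of_real ((a x)\<^sup>2))) \<le> K3 * a x + 64 * \<epsilon>"
    proof eventually_elim
      case (elim x)
      have a: "a x > 0" using elim(1) by (simp add: a_def)
      have "norm (R x / (c x * of_real ((a x)\<^sup>2))) = norm (R x) / (a x)^3"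
        using a by (simp add: norm_divide norm_mult a_def power3_eq_cube power2_eq_square)
      also have "\<dots> \<le> (K3 * (a x)^4 + 64 * \<epsilon> * (a x)^3) / (a x)^3"
        using elim(2) a by (intro divide_right_mono) auto
      also have "\<dots> = K3 * a x + 64 * \<epsilon>"
        using a by (simp add: add_divide_distrib power4_eq_xxxx power3_eq_cube)
      finally show ?case .
    qed
  qed
  have cis_lim: "((\<lambda>x. cis (- 2 * \<tau> x)) \<longlongrightarrow> cis (- 2 * (pi/2))) F"
    by (intro tendsto_cis tendsto_intros \<tau>)
  \<comment> \<open>The second mode is not resonant: \<open>2 * \<i>\<close> has modulus 2, while
    the other term of the denominator has modulus at most \<open>101/100\<close>. The limit is kept
    unevaluated so that the limit rules produce it literally.\<close>
  have m2: "((\<lambda>x. m x 2 / (c x)\<^sup>2) \<longlongrightarrow> - (of_real 1 * cis (- 2 * (pi/2)) * of_real B) / (2 * \<i> + of_real 1 * cis (- 2 * (pi/2)))) F"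
  proof (rule Lim_transform_eventually)
    show "((\<lambda>x. - (of_real (\<kappa> x) * cis (- 2 * \<tau> x) * (N x 2 / (c x)\<^sup>2)) / (2 * \<i> + of_real (\<kappa> x) * cis (- 2 * \<tau> x))) \<longlongrightarrow>
       - (of_real 1 * cis (- 2 * (pi/2)) * of_real B) / (2 * \<i> + of_real 1 * cis (- 2 * (pi/2)))) F"
      by (intro tendsto_intros \<kappa> cis_lim N2) (simp add: complex_eq_iff)
    show "\<forall>\<^sub>F x in F. - (of_real (\<kappa> x) * cis (- 2 * \<tau> x) * (N x 2 / (c x)\<^sup>2)) / (2 * \<i> + of_real (\<kappa> x) * cis (- 2 * \<tau> x))
       = m x 2 / (c x)\<^sup>2"
      using orbit near(1)
    proof eventually_elim
      case (elim x)
      interpret delay_orbit "u x" "\<lambda>s. G (u x s)" "\<kappa> x" "\<tau> x" by (rule elim)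
      let ?k = "of_real (\<kappa> x) * cis (- 2 * \<tau> x)"
      have "\<bar>\<kappa> x\<bar> \<le> 101/100" using elim(2) by linarith
      then have "norm ?k \<le> 101/100" by (simp add: norm_mult)
      have nz: "2 * \<i> + ?k \<noteq> 0"
      proof
        assume "2 * \<i> + ?k = 0"
        then have "?k = - (2 * \<i>)" by (simp only: add_eq_0_iff)
        then have "norm ?k = 2" by (simp only: norm_minus_cancel norm_mult norm_ii norm_numeral mult_1_right)
        with \<open>norm ?k \<le> 101/100\<close> show False by simp
      qed
      have "m x 2 * (2 * \<i> + ?k) = - (?k * N x 2)"
      proof -
        have "\<i> * 2 * m x 2 = - ?k * (m x 2 + N x 2)"
          using mode_eq[of 2] unfolding m_def N_def by simp
        then show ?thesis by algebra
      qed
      with nz have "m x 2 = - (?k * N x 2) / (2 * \<i> + ?k)" by (rule eq_divide_imp)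
      then show ?case by simp
    qed
  qed
  have "((\<lambda>x. - (of_real (2 * B) * (m x 0 / of_real ((a x)\<^sup>2) + m x 2 / (c x)\<^sup>2) + of_real (3 * C)
        + R x / (c x * of_real ((a x)\<^sup>2)))) \<longlongrightarrow>
     - (of_real (2 * B) * (of_real (- 2 * B) + - (of_real 1 * cis (- 2 * (pi/2)) * of_real B) / (2 * \<i> + of_real 1 * cis (- 2 * (pi/2)))) + of_real (3 * C) + 0)) F"
    by (intro tendsto_intros m0 m2 R)
  moreover have "- (of_real (2 * B) * (of_real (- 2 * B) + - (of_real 1 * cis (- 2 * (pi/2)) * of_real B) / (2 * \<i> + of_real 1 * cis (- 2 * (pi/2)))) + of_real (3 * C) + 0)
     = Complex (22/5 * B\<^sup>2 - 3 * C) (4/5 * B\<^sup>2)"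
    by (simp add: complex_eq_iff Re_divide Im_divide power2_eq_square field_simps)
  ultimately have lim: "((\<lambda>x. - (of_real (2 * B) * (m x 0 / of_real ((a x)\<^sup>2) + m x 2 / (c x)\<^sup>2) + of_real (3 * C)
        + R x / (c x * of_real ((a x)\<^sup>2)))) \<longlongrightarrow> Complex (22/5 * B\<^sup>2 - 3 * C) (4/5 * B\<^sup>2)) F"
    by simp
  show "((\<lambda>x. (1 + \<i> * cis (\<tau> x) / of_real (\<kappa> x)) / of_real ((norm (c x))\<^sup>2)) \<longlongrightarrow>
      Complex (22/5 * B\<^sup>2 - 3 * C) (4/5 * B\<^sup>2)) F"
  proof (rule Lim_transform_eventually[OF lim])
    show "\<forall>\<^sub>F x in F. - (of_real (2 * B) * (m x 0 / of_real ((a x)\<^sup>2) + m x 2 / (c x)\<^sup>2) + of_real (3 * C)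
        + R x / (c x * of_real ((a x)\<^sup>2))) = (1 + \<i> * cis (\<tau> x) / of_real (\<kappa> x)) / of_real ((norm (c x))\<^sup>2)"
      using orbit near(1) ne
    proof eventually_elim
      case (elim x)
      interpret delay_orbit "u x" "\<lambda>s. G (u x s)" "\<kappa> x" "\<tau> x" by (rule elim)
      have k: "complex_of_real (\<kappa> x) \<noteq> 0" using elim(2) by auto
      have c: "c x \<noteq> 0" "cnj (c x) \<noteq> 0" using elim(3) by auto
      have a: "complex_of_real ((a x)\<^sup>2) = c x * cnj (c x)" unfolding a_def by (rule complex_norm_square)
      have N1: "N x 1 = R x + (of_real (2 * B) * (c x * m x 0 + cnj (c x) * m x 2) + of_real (3 * C) * (c x * cnj (c x)) * c x)"
        unfolding R_def of_real_mult[of "3 * C"] a by simp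
      have "\<i> * c x = - of_real (\<kappa> x) * cis (- \<tau> x) * (c x + N x 1)"
        using mode_eq[of 1] unfolding cm m_def N_def by simp
      \<comment> \<open>Multiplying by \<open>cis (\<tau> x)\<close> cancels the phase of the delay
        and leaves the combination \<open>\<kappa> + \<i> * cis \<tau>\<close> in front of
        \<open>c\<close>.\<close>
      then have "cis (\<tau> x) * (\<i> * c x) = - of_real (\<kappa> x) * (cis (\<tau> x) * cis (- \<tau> x)) * (c x + N x 1)"
        by (simp add: mult_ac)
      then have "\<i> * cis (\<tau> x) * c x = - of_real (\<kappa> x) * (c x + N x 1)" by (simp add: cis_mult mult_ac)
      then have "(of_real (\<kappa> x) + \<i> * cis (\<tau> x)) * c x = - (N x 1 * of_real (\<kappa> x))" by algebra
      then have "1 + \<i> * cis (\<tau> x) / of_real (\<kappa> x) = - N x 1 / c x"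
        using k c by (simp add: divide_simps)
      then have "(1 + \<i> * cis (\<tau> x) / of_real (\<kappa> x)) / of_real ((a x)\<^sup>2) = - N x 1 / (c x * (c x * cnj (c x)))"
        unfolding a by simp
      also have "\<dots> = - (of_real (2 * B) * (m x 0 / (c x * cnj (c x)) + m x 2 / (c x)\<^sup>2) + of_real (3 * C)
        + R x / (c x * (c x * cnj (c x))))"
        unfolding N1 using c by (simp add: divide_simps power2_eq_square)
      finally show ?case unfolding a a_def[symmetric] by simp
    qed
  qed
qed

section \<open>The period along the Hopf branch\<close>

text \<open>The real part controls \<open>1 - sin \<tau> / \<kappa>\<close> and the imaginary part
  \<open>cos \<tau> / \<kappa>\<close>. Near \<open>pi/2\<close> the cosine is asymptotic to
  \<open>- (\<tau> - pi/2)\<close>, while \<open>1 - sin \<tau>\<close> is of smaller order than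
  \<open>a\<^sup>2\<close>.\<close>

lemma hopf_expansion:
  fixes \<kappa> \<tau> a :: "'a \<Rightarrow> real"
  assumes lim: "((\<lambda>x. (1 + \<i> * cis (\<tau> x) / of_real (\<kappa> x)) / of_real ((a x)\<^sup>2)) \<longlongrightarrow> Complex X Y) F"
    and \<kappa>: "(\<kappa> \<longlongrightarrow> 1) F" and \<tau>: "(\<tau> \<longlongrightarrow> pi/2) F"
  shows "((\<lambda>x. (\<tau> x - pi/2) / (a x)\<^sup>2) \<longlongrightarrow> - Y) F"
    and "((\<lambda>x. (\<kappa> x - 1) / (a x)\<^sup>2) \<longlongrightarrow> X) F"
proof -
  have \<kappa>0: "\<forall>\<^sub>F x in F. \<kappa> x \<noteq> 0"
    by (rule tendsto_imp_eventually_ne[OF \<kappa>]) simp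
  have re: "((\<lambda>x. (1 - sin (\<tau> x) / \<kappa> x) / (a x)\<^sup>2) \<longlongrightarrow> X) F"
    using tendsto_Re[OF lim] by (simp add: Re_divide_of_real flip: of_real_power)
  have im: "((\<lambda>x. (cos (\<tau> x) / \<kappa> x) / (a x)\<^sup>2) \<longlongrightarrow> Y) F"
    using tendsto_Im[OF lim] by (simp add: Im_divide_of_real flip: of_real_power)
  have cos: "((\<lambda>x. cos (\<tau> x) / (a x)\<^sup>2) \<longlongrightarrow> 1 * Y) F"
    by (rule Lim_transform_eventually[OF tendsto_mult[OF \<kappa> im]])
       (use \<kappa>0 in eventually_elim, simp)
  have sin: "((\<lambda>x. (\<kappa> x - sin (\<tau> x)) / (a x)\<^sup>2) \<longlongrightarrow> 1 * X) F"
    by (rule Lim_transform_eventually[OF tendsto_mult[OF \<kappa> re]])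
       (use \<kappa>0 in \<open>eventually_elim, simp add: right_diff_distrib\<close>)
  \<comment> \<open>The Caratheodory form of the derivative of the sine at 0 avoids dividing by
    \<open>\<tau> - pi/2\<close>, which may vanish.\<close>
  obtain g :: "real \<Rightarrow> real" where g: "\<And>z. sin z - sin 0 = g z * (z - 0)" "isCont g 0" "g 0 = 1"
    using DERIV_sin[of 0] unfolding CARAT_DERIV by auto
  have g1: "((\<lambda>x. g (\<tau> x - pi/2)) \<longlongrightarrow> 1) F"
  proof -
    have "((\<lambda>x. \<tau> x - pi/2) \<longlongrightarrow> pi/2 - pi/2) F" by (intro tendsto_intros \<tau>)
    then have "((\<lambda>x. \<tau> x - pi/2) \<longlongrightarrow> 0) F" by simp
    from isCont_tendsto_compose[OF g(2) this] show ?thesis by (simp add: g(3))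
  qed
  have "((\<lambda>x. - (cos (\<tau> x) / (a x)\<^sup>2) / g (\<tau> x - pi/2)) \<longlongrightarrow> - (1 * Y) / 1) F"
    by (intro tendsto_intros cos g1) simp
  moreover have "\<forall>\<^sub>F x in F. - (cos (\<tau> x) / (a x)\<^sup>2) / g (\<tau> x - pi/2) = (\<tau> x - pi/2) / (a x)\<^sup>2"
    using tendsto_imp_eventually_ne[OF g1, of 0, simplified]
  proof eventually_elim
    case (elim x)
    have "- cos (\<tau> x) = g (\<tau> x - pi/2) * (\<tau> x - pi/2)"
      using g(1)[of "\<tau> x - pi/2"] by (simp add: sin_diff)
    then show ?case using elim by (simp add: divide_simps)
  qed
  ultimately show "((\<lambda>x. (\<tau> x - pi/2) / (a x)\<^sup>2) \<longlongrightarrow> - Y) F"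
    using Lim_transform_eventually by fastforce
  have s1: "((\<lambda>x. sin (\<tau> x)) \<longlongrightarrow> 1) F" and c0: "((\<lambda>x. cos (\<tau> x)) \<longlongrightarrow> 0) F"
    using isCont_tendsto_compose[OF isCont_sin \<tau>] isCont_tendsto_compose[OF isCont_cos \<tau>] by simp_all
  \<comment> \<open>From \<open>1 - sin \<tau> = cos \<tau> * cos \<tau> / (1 + sin \<tau>)\<close>:
    one cosine is divided by \<open>a\<^sup>2\<close> and stays bounded, the other tends to
    0.\<close>
  have "((\<lambda>x. (cos (\<tau> x) / (a x)\<^sup>2) * cos (\<tau> x) / (1 + sin (\<tau> x))) \<longlongrightarrow> (1 * Y) * 0 / (1 + 1)) F"
    by (intro tendsto_intros cos c0 s1) simp
  moreover have "\<forall>\<^sub>F x in F. (cos (\<tau> x) / (a x)\<^sup>2) * cos (\<tau> x) / (1 + sin (\<tau> x)) = (1 - sin (\<tau> x)) / (a x)\<^sup>2"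
    using order_tendstoD(1)[OF s1, of 0, simplified]
  proof eventually_elim
    case (elim x)
    have "cos (\<tau> x) * cos (\<tau> x) = (1 - sin (\<tau> x)) * (1 + sin (\<tau> x))"
      using sin_cos_squared_add[of "\<tau> x"] by (simp add: algebra_simps power2_eq_square)
    then have "(cos (\<tau> x) / (a x)\<^sup>2) * cos (\<tau> x) / (1 + sin (\<tau> x)) = (1 - sin (\<tau> x)) * (1 + sin (\<tau> x)) / (a x)\<^sup>2 / (1 + sin (\<tau> x))"
      by simp
    then show ?case using elim by simp
  qed
  ultimately have "((\<lambda>x. (1 - sin (\<tau> x)) / (a x)\<^sup>2) \<longlongrightarrow> 0) F"
    using Lim_transform_eventually by fastforce
  from tendsto_diff[OF sin this] show "((\<lambda>x. (\<kappa> x - 1) / (a x)\<^sup>2) \<longlongrightarrow> X) F"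
    by (simp add: diff_divide_distrib[symmetric])
qed

section \<open>Expansion of the nonlinearity, the Hopf threshold and rescaling of time\<close>

text \<open>Taylor's formula with Lagrange remainder evaluates the third derivative at an
  intermediate point; continuity lets its value at 0 replace it. The tolerance
  \<open>6 * \<epsilon>\<close> accounts for the factorial of 3.\<close>

lemma C3_fun_third_order:
  assumes f: "C3_fun f" "f 0 = 0" "deriv f 0 = 1" and \<epsilon>: "\<epsilon> > 0"
  shows "\<exists>d>0. \<forall>y. \<bar>y\<bar> < d \<longrightarrow>
    \<bar>(f y - y) - (coefB f * y\<^sup>2 + coefC f * y^3)\<bar> \<le> \<epsilon> * \<bar>y\<bar>^3"
proof -
  define D where "D n = (deriv ^^ n) f" for n
  have "isCont (D 3) 0"
    using f(1) unfolding C3_fun_def D_def by (simp add: continuous_on_eq_continuous_at)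
  then obtain d where d: "d > 0" "\<And>y. \<bar>y\<bar> < d \<Longrightarrow> \<bar>D 3 y - D 3 0\<bar> < 6 * \<epsilon>"
    using \<epsilon> unfolding continuous_at_eps_delta dist_real_def
    by (metis diff_zero mult_pos_pos zero_less_numeral)
  have der: "(D n has_real_derivative D (Suc n) x) (at x)" if "n < 3" for n x
  proof -
    have "D n differentiable at x"
      using f(1) that unfolding C3_fun_def D_def
      by (auto simp: less_Suc_eq numeral_3_eq_3)
    then show ?thesis unfolding D_def by (simp add: DERIV_deriv_iff_real_differentiable)
  qed
  have "\<bar>(f y - y) - (coefB f * y\<^sup>2 + coefC f * y^3)\<bar> \<le> \<epsilon> * \<bar>y\<bar>^3" if y: "\<bar>y\<bar> < d" for y
  proof -
    obtain t where t: "\<bar>t\<bar> \<le> \<bar>y\<bar>" "f y = (\<Sum>m<3. D m 0 / fact m * y^m) + D 3 t / fact 3 * y^3"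
      using Maclaurin_bi_le[of D f 3 y] der by (auto simp: D_def)
    have "(\<Sum>m<3. D m 0 / fact m * y^m) = y + coefB f * y\<^sup>2"
      using f by (simp add: numeral_3_eq_3 D_def coefB_def power2_eq_square)
    then have "(f y - y) - (coefB f * y\<^sup>2 + coefC f * y^3) = (D 3 t - D 3 0) / 6 * y^3"
      using t(2) by (simp add: coefC_def D_def fact_numeral algebra_simps diff_divide_distrib)
    then have "\<bar>(f y - y) - (coefB f * y\<^sup>2 + coefC f * y^3)\<bar> = \<bar>D 3 t - D 3 0\<bar> / 6 * \<bar>y\<bar>^3"
      by (simp only: abs_mult power_abs abs_divide abs_numeral)
    also have "\<dots> \<le> \<epsilon> * \<bar>y\<bar>^3"
      using d(2)[of t] t(1) y by (intro mult_right_mono) auto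
    finally show ?thesis .
  qed
  then show ?thesis using d(1) by blast
qed

lemma mu_pos: "mu m > 0"
  by (simp add: mu_def)

lemma mu_add: "mu (m + j) = mu m + 2 * pi * real j"
  by (simp add: mu_def algebra_simps add_divide_distrib)

lemma H_eq: "H m = (22 - 4 / mu m) / 15"
proof -
  have "(4 * real m + 1) * pi \<noteq> 0" by (simp add: add_nonneg_eq_0_iff)
  then show ?thesis unfolding H_def mu_def by (simp add: divide_simps)
qed

text \<open>Written through \<open>mu m\<close>, the threshold condition becomes linear in
  \<open>mu m\<close>. Its coefficients are the real and imaginary parts of the limit in
  \<open>delay_orbit_normal_form\<close>, which links the Hopf criterion to the frequency.\<close>

lemma coefC_gt_H_iff:
  "coefC f > H m * (coefB f)\<^sup>2 \<longleftrightarrow>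
    (22/5 * (coefB f)\<^sup>2 - 3 * coefC f) * mu m < 4/5 * (coefB f)\<^sup>2"
proof -
  have "coefC f > H m * (coefB f)\<^sup>2 \<longleftrightarrow> 15 * coefC f * mu m > (22 * mu m - 4) * (coefB f)\<^sup>2"
    using mu_pos[of m] unfolding H_eq by (simp add: field_simps)
  also have "\<dots> \<longleftrightarrow> (22/5 * (coefB f)\<^sup>2 - 3 * coefC f) * mu m < 4/5 * (coefB f)\<^sup>2"
    by (simp add: algebra_simps)
  finally show ?thesis .
qed

text \<open>A constant function would already have the period \<open>T / 2\<close>.\<close>

lemma minimal_period_imp_nonconstant:
  assumes "minimal_period x T"
  shows "\<exists>t. x t \<noteq> c"
  using assms unfolding minimal_period_def
  by (metis field_sum_of_halves less_add_same_cancel1 half_gt_zero)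

text \<open>Scaling the period to \<open>2 * pi\<close> turns the delay 1 into
  \<open>\<omega>\<close>. Periodicity allows \<open>k\<close> full turns to be subtracted, which
  brings the delay near \<open>pi/2\<close> for every \<open>k\<close>.\<close>

lemma is_solution_delay_orbit:
  assumes sol: "is_solution \<mu> f x" and per: "\<And>t. x (t + T) = x t" and T: "T > 0"
    and f: "continuous_on UNIV f"
  defines "\<omega> \<equiv> 2 * pi / T"
  shows "delay_orbit (\<lambda>s. x (s / \<omega>)) (\<lambda>s. f (x (s / \<omega>)) - x (s / \<omega>)) (\<mu> / \<omega>) (\<omega> - 2 * pi * real k)"
proof
  have \<omega>: "\<omega> > 0" using T by (simp add: \<omega>_def)
  have "2 * pi / \<omega> = T" using T by (simp add: \<omega>_def)
  then show per2: "x ((s + 2 * pi) / \<omega>) = x (s / \<omega>)" for s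
    using per[of "s / \<omega>"] by (simp add: add_divide_distrib)
  then show "f (x ((s + 2 * pi) / \<omega>)) - x ((s + 2 * pi) / \<omega>) = f (x (s / \<omega>)) - x (s / \<omega>)" for s
    by simp
  have dx: "(x has_real_derivative - \<mu> * f (x (t - 1))) (at t)" for t
    using sol by (simp add: is_solution_def)
  then have cx: "continuous_on UNIV x"
    by (meson DERIV_isCont continuous_at_imp_continuous_on)
  have cu: "continuous_on UNIV (\<lambda>s. x (s / \<omega>))"
    by (rule continuous_on_compose2[OF cx]) (use \<omega> in \<open>auto intro!: continuous_intros\<close>)
  show "continuous_on UNIV (\<lambda>s. f (x (s / \<omega>)) - x (s / \<omega>))"
    by (intro continuous_on_diff cu continuous_on_compose2[OF f cu]) auto
  fix s
  have "((\<lambda>s. s / \<omega>) has_real_derivative 1 / \<omega>) (at s)"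
    using \<omega> by (auto intro!: derivative_eq_intros)
  from DERIV_chain2[OF dx this]
  have "((\<lambda>s. x (s / \<omega>)) has_real_derivative - \<mu> * f (x (s / \<omega> - 1)) * (1 / \<omega>)) (at s)" .
  moreover have "x ((s - (\<omega> - 2 * pi * real k)) / \<omega>) = x (s / \<omega> - 1)"
  proof -
    have "x (((s - \<omega>) + 2 * pi * of_int (int k)) / \<omega>) = x ((s - \<omega>) / \<omega>)"
      by (rule periodic_2pi_multiple[where v = "\<lambda>s. x (s / \<omega>)"]) (rule per2)
    then show ?thesis using \<omega> by (simp add: diff_divide_distrib algebra_simps)
  qed
  ultimately show "((\<lambda>s. x (s / \<omega>)) has_real_derivative
      - (\<mu> / \<omega>) * (x ((s - (\<omega> - 2 * pi * real k)) / \<omega>)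
        + (f (x ((s - (\<omega> - 2 * pi * real k)) / \<omega>)) - x ((s - (\<omega> - 2 * pi * real k)) / \<omega>)))) (at s)"
    by simp
qed

section \<open>From the slope of the frequency to bounds on the period\<close>

text \<open>Cross-multiplication reduces both inequalities to the sign of
  \<open>\<eta> * h \<eta>\<close>. The limit of \<open>h\<close> is a positive multiple of
  \<open>Y - X * (\<mu> + 2 * pi * M)\<close>, so the sign depends on whether the shifted parameter
  lies above or below the threshold.\<close>

lemma period_comparison:
  fixes \<omega> :: "real \<Rightarrow> real" and X Y M \<mu> :: real
  assumes \<omega>: "(\<omega> \<longlongrightarrow> \<mu>) (at_right 0)"
    and slope: "((\<lambda>\<eta>. (\<omega> \<eta> - \<mu>) / \<eta>) \<longlongrightarrow> - Y / (Y - X * \<mu>)) (at_right 0)"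
    and \<mu>: "\<mu> > 0" and P: "X * \<mu> < Y" and M: "M > 0"
  shows "X * (\<mu> + 2 * pi * M) > Y \<Longrightarrow> \<forall>\<^sub>F \<eta> in at_right 0. (2 * pi + \<eta> / M) / (\<mu> - \<eta>) < 2 * pi / \<omega> \<eta>"
    and "X * (\<mu> + 2 * pi * M) < Y \<Longrightarrow> \<forall>\<^sub>F \<eta> in at_right 0. (2 * pi + \<eta> / M) / (\<mu> - \<eta>) > 2 * pi / \<omega> \<eta>"
proof -
  define h where "h \<eta> = 2 * pi * ((\<omega> \<eta> - \<mu>) / \<eta>) + \<omega> \<eta> / M + 2 * pi" for \<eta>
  have h: "(h \<longlongrightarrow> 2 * pi * (- Y / (Y - X * \<mu>)) + \<mu> / M + 2 * pi) (at_right 0)"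
    unfolding h_def [abs_def] by (intro tendsto_intros \<omega> slope) (use M in auto)
  have l: "2 * pi * (- Y / (Y - X * \<mu>)) + \<mu> / M + 2 * pi = \<mu> * (Y - X * (\<mu> + 2 * pi * M)) / (M * (Y - X * \<mu>))"
    using P M by (simp add: divide_simps) (simp add: algebra_simps)
  have ev: "\<forall>\<^sub>F \<eta> in at_right 0. \<eta> > 0 \<and> \<eta> < \<mu> \<and> \<omega> \<eta> > 0"
    using order_tendstoD(1)[OF \<omega> \<mu>] eventually_at_right_less[of 0] eventually_at_right_field[of "\<lambda>\<eta>. \<eta> < \<mu>" 0] \<mu>
    by (auto simp: eventually_conj_iff)
  have eq: "(2 * pi + \<eta> / M) * \<omega> \<eta> - 2 * pi * (\<mu> - \<eta>) = \<eta> * h \<eta>" if "\<eta> > 0" for \<eta>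
    using that M by (simp add: h_def field_simps)
  {
    assume "X * (\<mu> + 2 * pi * M) > Y"
    then have "\<mu> * (Y - X * (\<mu> + 2 * pi * M)) / (M * (Y - X * \<mu>)) < 0"
      using \<mu> M P by (intro divide_neg_pos mult_pos_neg mult_pos_pos) auto
    then have "\<forall>\<^sub>F \<eta> in at_right 0. h \<eta> < 0"
      using order_tendstoD(2)[OF h] unfolding l by blast
    with ev show "\<forall>\<^sub>F \<eta> in at_right 0. (2 * pi + \<eta> / M) / (\<mu> - \<eta>) < 2 * pi / \<omega> \<eta>"
    proof eventually_elim
      case (elim \<eta>)
      then have "\<eta> * h \<eta> < 0" by (simp add: mult_pos_neg)
      then have "(2 * pi + \<eta> / M) * \<omega> \<eta> < 2 * pi * (\<mu> - \<eta>)" using eq[of \<eta>] elim by linarith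
      then show ?case using elim by (simp add: pos_divide_less_eq pos_less_divide_eq)
    qed
  }
  {
    assume "X * (\<mu> + 2 * pi * M) < Y"
    then have "\<mu> * (Y - X * (\<mu> + 2 * pi * M)) / (M * (Y - X * \<mu>)) > 0"
      using \<mu> M P by (intro divide_pos_pos mult_pos_pos) auto
    then have "\<forall>\<^sub>F \<eta> in at_right 0. h \<eta> > 0"
      using order_tendstoD(1)[OF h] unfolding l by blast
    with ev show "\<forall>\<^sub>F \<eta> in at_right 0. (2 * pi + \<eta> / M) / (\<mu> - \<eta>) > 2 * pi / \<omega> \<eta>"
    proof eventually_elim
      case (elim \<eta>)
      then have "\<eta> * h \<eta> > 0" by simp
      then have "(2 * pi + \<eta> / M) * \<omega> \<eta> > 2 * pi * (\<mu> - \<eta>)" using eq[of \<eta>] elim by linarith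
      then show ?case using elim by (simp add: pos_divide_less_eq pos_less_divide_eq)
    qed
  }
qed

text \<open>Both \<open>\<omega> - mu k\<close> and \<open>\<eta>\<close> are asymptotic to
  multiples of the squared amplitude; their quotient eliminates the amplitude. Subcriticality makes
  the limit \<open>Y - X * mu k\<close> of the denominator positive.\<close>

lemma hopf_branch_frequency:
  fixes f :: "real \<Rightarrow> real"
  assumes f: "C3_fun f" "f 0 = 0" "deriv f 0 = 1"
    and sub: "hopf_subcritical f k" and branch: "hopf_branch f k \<eta>0 p T"
  defines "X \<equiv> 22/5 * (coefB f)\<^sup>2 - 3 * coefC f" and "Y \<equiv> 4/5 * (coefB f)\<^sup>2"
  shows "((\<lambda>\<eta>. 2 * pi / T \<eta>) \<longlongrightarrow> mu k) (at_right 0)"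
    and "((\<lambda>\<eta>. (2 * pi / T \<eta> - mu k) / \<eta>) \<longlongrightarrow> - Y / (Y - X * mu k)) (at_right 0)"
proof -
  define \<omega> where "\<omega> \<eta> = 2 * pi / T \<eta>" for \<eta>
  define u where "u \<eta> s = p \<eta> (s / \<omega> \<eta>)" for \<eta> s
  define \<kappa> where "\<kappa> \<eta> = (mu k - \<eta>) / \<omega> \<eta>" for \<eta>
  define \<tau> where "\<tau> \<eta> = \<omega> \<eta> - 2 * pi * real k" for \<eta>
  define a where "a \<eta> = norm (delay_orbit.mode (u \<eta>) 1)" for \<eta>
  have P: "Y - X * mu k > 0"
    using sub unfolding hopf_subcritical_def coefC_gt_H_iff X_def Y_def by simp
  have delta: "hopf_delta f k = -1"
    using sub by (simp add: hopf_delta_def hopf_subcritical_def hopf_supercritical_def)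
  have sol: "is_solution (mu k - \<eta>) f (p \<eta>)" "minimal_period (p \<eta>) (T \<eta>)" if "0 < \<eta>" "\<eta> < \<eta>0" for \<eta>
    using branch that delta unfolding hopf_branch_def by auto
  have ev: "\<forall>\<^sub>F \<eta> in at_right 0. 0 < \<eta> \<and> \<eta> < \<eta>0"
    using branch unfolding hopf_branch_def by (auto simp: eventually_at_right_field)
  have cf: "continuous_on UNIV f"
    using f(1) unfolding C3_fun_def
    by (meson continuous_at_imp_continuous_on differentiable_imp_continuous_within)
  have "((\<lambda>\<eta>. 2 * pi / T \<eta>) \<longlongrightarrow> 2 * pi / (4 / (4 * real k + 1))) (at_right 0)"
    using branch unfolding hopf_branch_def
    by (intro tendsto_intros) (auto simp: add_nonneg_eq_0_iff)
  also have "2 * pi / (4 / (4 * real k + 1)) = mu k" by (simp add: mu_def field_simps)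
  finally show lim\<omega>: "((\<lambda>\<eta>. 2 * pi / T \<eta>) \<longlongrightarrow> mu k) (at_right 0)" .
  note lim\<omega>' = lim\<omega>[folded \<omega>_def]
  have \<omega>pos: "\<forall>\<^sub>F \<eta> in at_right 0. \<omega> \<eta> > 0"
    using order_tendstoD(1)[OF lim\<omega>' mu_pos] .
  have lim\<eta>: "((\<lambda>\<eta>::real. \<eta>) \<longlongrightarrow> 0) (at_right 0)" by (rule tendsto_ident_at)
  have "(\<kappa> \<longlongrightarrow> (mu k - 0) / mu k) (at_right 0)"
    unfolding \<kappa>_def [abs_def] by (intro tendsto_intros lim\<omega>' lim\<eta>) (use mu_pos[of k] in simp)
  then have \<kappa>: "(\<kappa> \<longlongrightarrow> 1) (at_right 0)" using mu_pos[of k] by simp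
  have "(\<tau> \<longlongrightarrow> mu k - 2 * pi * real k) (at_right 0)"
    unfolding \<tau>_def [abs_def] by (intro tendsto_intros lim\<omega>')
  moreover have mk: "mu k - 2 * pi * real k = pi / 2"
    by (simp add: mu_def field_simps)
  ultimately have \<tau>: "(\<tau> \<longlongrightarrow> pi/2) (at_right 0)" by simp
  have orbit: "\<forall>\<^sub>F \<eta> in at_right 0. delay_orbit (u \<eta>) (\<lambda>s. f (u \<eta> s) - u \<eta> s) (\<kappa> \<eta>) (\<tau> \<eta>)"
    using ev
  proof eventually_elim
    case (elim \<eta>)
    have "T \<eta> > 0" "\<And>t. p \<eta> (t + T \<eta>) = p \<eta> t"
      using sol(2)[of \<eta>] elim by (auto simp: minimal_period_def)
    from is_solution_delay_orbit[OF sol(1) this(2,1) cf] elim show ?case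
      unfolding u_def [abs_def] \<kappa>_def \<tau>_def \<omega>_def by simp
  qed
  have nontrivial: "\<forall>\<^sub>F \<eta> in at_right 0. \<exists>s. u \<eta> s \<noteq> 0"
    using ev \<omega>pos
  proof eventually_elim
    case (elim \<eta>)
    obtain t where "p \<eta> t \<noteq> 0"
      using minimal_period_imp_nonconstant[OF sol(2)] elim by blast
    then have "u \<eta> (t * \<omega> \<eta>) \<noteq> 0" using elim by (simp add: u_def)
    then show ?case by blast
  qed
  have small: "\<forall>\<^sub>F \<eta> in at_right 0. \<forall>s. \<bar>u \<eta> s\<bar> < \<epsilon>" if "\<epsilon> > 0" for \<epsilon>
  proof -
    have "\<forall>\<^sub>F \<eta> in at_right 0. \<forall>t. \<bar>p \<eta> t\<bar> < \<epsilon>"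
      using branch that unfolding hopf_branch_def by blast
    then show ?thesis by eventually_elim (simp add: u_def)
  qed
  note nf = delay_orbit_normal_form[where G = "\<lambda>y. f y - y" and B = "coefB f" and C = "coefC f",
      OF orbit nontrivial \<kappa> \<tau> small C3_fun_third_order[OF f]]
  have a: "\<forall>\<^sub>F \<eta> in at_right 0. a \<eta> > 0"
    using nf(1) by (simp add: a_def)
  have lim_\<tau>: "((\<lambda>\<eta>. (\<tau> \<eta> - pi/2) / (a \<eta>)\<^sup>2) \<longlongrightarrow> - Y) (at_right 0)"
    and lim_\<kappa>: "((\<lambda>\<eta>. (\<kappa> \<eta> - 1) / (a \<eta>)\<^sup>2) \<longlongrightarrow> X) (at_right 0)"
    using hopf_expansion[OF nf(3) \<kappa> \<tau>] unfolding a_def X_def Y_def by blast+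
  \<comment> \<open>On a subcritical branch the parameter is \<open>mu k - \<eta>\<close>, so
    \<open>\<omega> * (\<kappa> - 1) = mu k - \<eta> - \<omega>\<close>. Together with
    \<open>\<tau> - pi/2 = \<omega> - mu k\<close> this recovers \<open>\<eta>\<close>.\<close>
  have "((\<lambda>\<eta>. - (\<omega> \<eta> * ((\<kappa> \<eta> - 1) / (a \<eta>)\<^sup>2)) - (\<tau> \<eta> - pi/2) / (a \<eta>)\<^sup>2) \<longlongrightarrow> - (mu k * X) - (- Y)) (at_right 0)"
    by (intro tendsto_intros lim\<omega>' lim_\<kappa> lim_\<tau>)
  moreover have "\<forall>\<^sub>F \<eta> in at_right 0.
      - (\<omega> \<eta> * ((\<kappa> \<eta> - 1) / (a \<eta>)\<^sup>2)) - (\<tau> \<eta> - pi/2) / (a \<eta>)\<^sup>2 = \<eta> / (a \<eta>)\<^sup>2"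
    using \<omega>pos
  proof eventually_elim
    case (elim \<eta>)
    have "\<omega> \<eta> * (\<kappa> \<eta> - 1) = mu k - \<eta> - \<omega> \<eta>"
    proof -
      have "\<omega> \<eta> * \<kappa> \<eta> = mu k - \<eta>" using elim by (simp add: \<kappa>_def)
      then show ?thesis by (simp add: right_diff_distrib)
    qed
    then have "- (\<omega> \<eta> * (\<kappa> \<eta> - 1)) - (\<tau> \<eta> - pi/2) = \<eta>"
      using mk by (simp add: \<tau>_def)
    then show ?case by (metis times_divide_eq_right diff_divide_distrib minus_divide_left)
  qed
  ultimately have lim_\<eta>: "((\<lambda>\<eta>. \<eta> / (a \<eta>)\<^sup>2) \<longlongrightarrow> Y - X * mu k) (at_right 0)"
    using Lim_transform_eventually by (fastforce simp: mult.commute)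
  have "((\<lambda>\<eta>. ((\<tau> \<eta> - pi/2) / (a \<eta>)\<^sup>2) / (\<eta> / (a \<eta>)\<^sup>2)) \<longlongrightarrow> - Y / (Y - X * mu k)) (at_right 0)"
    by (intro tendsto_intros lim_\<tau> lim_\<eta>) (use P in simp)
  then show "((\<lambda>\<eta>. (2 * pi / T \<eta> - mu k) / \<eta>) \<longlongrightarrow> - Y / (Y - X * mu k)) (at_right 0)"
  proof (rule Lim_transform_eventually)
    show "\<forall>\<^sub>F \<eta> in at_right 0. ((\<tau> \<eta> - pi/2) / (a \<eta>)\<^sup>2) / (\<eta> / (a \<eta>)\<^sup>2) = (2 * pi / T \<eta> - mu k) / \<eta>"
      using a by eventually_elim (use mk in \<open>simp add: \<tau>_def \<omega>_def\<close>)
  qed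
qed

theorem theorem4:
  fixes f :: "real \<Rightarrow> real" and k n :: nat
  assumes f: "C3_fun f" "f 0 = 0" "deriv f 0 = 1"
    and lo: "(22 * pi - 8) / (15 * pi) * (coefB f)^2 < coefC f"
    and hi: "coefC f < 22 / 15 * (coefB f)^2"
    and nondeg: "\<forall>m::nat. coefC f \<noteq> H m * (coefB f)^2"
    and n_def: "n = Max {m::nat. coefC f > H m * (coefB f)^2}"
    and k: "k \<le> n"
  shows "hopf_subcritical f k \<and>
    (\<forall>\<eta>0 p T. hopf_branch f k \<eta>0 p T \<longrightarrow>
      (\<forall>\<^sub>F \<eta> in at_right 0.
        (k < n \<longrightarrow>
           (4 + 2 * \<eta> / ((real (n - k) + 1) * pi)) / (4 * real k + 1 - 2 * \<eta> / pi) < T \<eta> \<and>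
           T \<eta> < (4 + 2 * \<eta> / (real (n - k) * pi)) / (4 * real k + 1 - 2 * \<eta> / pi)) \<and>
        (k = n \<longrightarrow>
           T \<eta> > (4 + 2 * \<eta> / pi) / (4 * real k + 1 - 2 * \<eta> / pi))))"
proof -
  define X where "X = 22/5 * (coefB f)\<^sup>2 - 3 * coefC f"
  define Y where "Y = 4/5 * (coefB f)\<^sup>2"
  have X: "X > 0" using hi by (simp add: X_def)
  have set_eq: "{m. coefC f > H m * (coefB f)\<^sup>2} = {m. X * mu m < Y}"
    by (simp add: coefC_gt_H_iff X_def Y_def)
  have mono: "X * mu i \<le> X * mu j" if "i \<le> j" for i j
    using X that by (intro mult_left_mono) (auto simp: mu_def)
  \<comment> \<open>Since \<open>X > 0\<close> and \<open>mu\<close> is unbounded, only finitely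
    many indices satisfy the condition, so \<open>Max\<close> is a genuine maximum.\<close>
  obtain N where N: "real N > Y / X" using reals_Archimedean2 by blast
  have "{m. X * mu m < Y} \<subseteq> {..N}"
  proof
    fix m assume "m \<in> {m. X * mu m < Y}"
    then have "mu m < Y / X" using X by (simp add: field_simps)
    moreover have "real m \<le> mu m"
    proof -
      have "(4 * real m + 1) * 2 \<le> (4 * real m + 1) * pi" using pi_ge_two by (intro mult_left_mono) auto
      then show ?thesis by (simp add: mu_def)
    qed
    ultimately show "m \<in> {..N}" using N by simp
  qed
  then have fin: "finite {m. X * mu m < Y}" using finite_subset by blast
  have "H 0 = (22 * pi - 8) / (15 * pi)" by (simp add: H_def)
  then have "X * mu 0 < Y" using lo set_eq by auto
  then have n: "X * mu n < Y"
    using Max_in[OF fin] n_def unfolding set_eq by blast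
  \<comment> \<open>Maximality of \<open>n\<close> gives the weak inequality at
    \<open>Suc n\<close>; nondegeneracy then excludes equality.\<close>
  have "\<not> X * mu (Suc n) < Y"
    using Max_ge[OF fin, of "Suc n"] n_def unfolding set_eq by auto
  moreover have "X * mu (Suc n) \<noteq> Y"
  proof
    assume "X * mu (Suc n) = Y"
    then have "coefC f = H (Suc n) * (coefB f)\<^sup>2"
      using mu_pos[of "Suc n"] unfolding H_eq X_def Y_def by (simp add: field_simps)
    then show False using nondeg by blast
  qed
  ultimately have Sn: "X * mu (Suc n) > Y" by linarith
  have Xk: "X * mu k < Y" using mono[OF k] n by linarith
  have sub: "hopf_subcritical f k"
    using Xk set_eq unfolding hopf_subcritical_def by blast
  \<comment> \<open>Numerator and denominator are multiplied by \<open>pi / 2\<close>, which brings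
    the stated bounds to the form used in \<open>period_comparison\<close>.\<close>
  have scale: "(4 + 2 * \<eta> / (j * pi)) / (4 * real k + 1 - 2 * \<eta> / pi) = (2 * pi + \<eta> / j) / (mu k - \<eta>)"
    if "j > 0" for j \<eta> :: real
  proof -
    have "mu k - \<eta> = (4 * real k + 1 - 2 * \<eta> / pi) * (pi / 2)"
      by (simp add: mu_def field_simps)
    moreover have "2 * pi + \<eta> / j = (4 + 2 * \<eta> / (j * pi)) * (pi / 2)"
      using that by (simp add: field_simps)
    ultimately show ?thesis
      by (metis nonzero_mult_divide_mult_cancel_right pi_half_neq_zero)
  qed
  have "\<forall>\<^sub>F \<eta> in at_right 0.
        (k < n \<longrightarrow>
           (4 + 2 * \<eta> / ((real (n - k) + 1) * pi)) / (4 * real k + 1 - 2 * \<eta> / pi) < T \<eta> \<and>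
           T \<eta> < (4 + 2 * \<eta> / (real (n - k) * pi)) / (4 * real k + 1 - 2 * \<eta> / pi)) \<and>
        (k = n \<longrightarrow> T \<eta> > (4 + 2 * \<eta> / pi) / (4 * real k + 1 - 2 * \<eta> / pi))"
    if branch: "hopf_branch f k \<eta>0 p T" for \<eta>0 p T
  proof -
    note cmp = period_comparison[OF hopf_branch_frequency[OF f sub branch, folded X_def Y_def] mu_pos Xk]
    have T: "2 * pi / (2 * pi / T \<eta>) = T \<eta>" for \<eta> by simp
    \<comment> \<open>Raising the index by one adds \<open>2 * pi\<close> to \<open>mu\<close>.
      Hence \<open>M = n - k + 1\<close> leads to \<open>mu (Suc n)\<close>, beyond the threshold,
      and \<open>M = n - k\<close> to \<open>mu n\<close>, before it. For \<open>k = n\<close> the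
      first choice is \<open>M = 1\<close>, the bound claimed in that case.\<close>
    have "mu k + 2 * pi * (real (n - k) + 1) = mu (Suc n)"
      using mu_add[of k "Suc n - k"] k by (simp add: Suc_diff_le algebra_simps)
    then have lower: "\<forall>\<^sub>F \<eta> in at_right 0. (2 * pi + \<eta> / (real (n - k) + 1)) / (mu k - \<eta>) < T \<eta>"
      using cmp(1)[of "real (n - k) + 1"] Sn unfolding T by simp
    have upper: "\<forall>\<^sub>F \<eta> in at_right 0. k < n \<longrightarrow> (2 * pi + \<eta> / real (n - k)) / (mu k - \<eta>) > T \<eta>"
    proof (cases "k < n")
      case True
      then have "mu k + 2 * pi * real (n - k) = mu n" using mu_add[of k "n - k"] by simp
      then show ?thesis using cmp(2)[of "real (n - k)"] n True unfolding T by simp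
    qed simp
    from lower upper show ?thesis
    proof eventually_elim
      case (elim \<eta>)
      then show ?case
        using scale[of "real (n - k) + 1" \<eta>] scale[of "real (n - k)" \<eta>] by auto
    qed
  qed
  then show ?thesis using sub by blast
qed

end
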